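(* Let $k\geq 1$ be an integer and let $r_k(n)$ denote the number of representations of the positive integer $n$ as a sum of $k$ squares of integers (counting order and signs). Let $J_\nu$ and $I_\nu$ denote the Bessel function and the modified Bessel function of the first kind. If $x>y>0$, then \begin{align*} \frac{(\pi y)^{\frac{k}{4}-\frac{1}{2}}}{2^{\frac{k}{4}-\frac{1}{2}}\Gamma\left(\frac{k}{4}+\frac{1}{2}\right)}&+\sum_{n=1}^{\infty}\frac{r_{k}(n)}{n^{\frac{k}{4}-\frac{1}{2}}}\,e^{-\pi nx}J_{\frac{k}{4}-\frac{1}{2}}\left(\pi ny\right)\\ &=\frac{(\pi y)^{\frac{k}{4}-\frac{1}{2}}}{2^{\frac{k}{4}-\frac{1}{2}}\Gamma\left(\frac{k}{4}+\frac{1}{2}\right)\left(x^{2}+y^{2}\right)^{\frac{k}{4}}}+\frac{1}{\sqrt{x^{2}+y^{2}}}\,\sum_{n=1}^{\infty}\frac{r_{k}(n)}{n^{\frac{k}{4}-\frac{1}{2}}}\,e^{-\frac{\pi nx}{x^{2}+y^{2}}} J_{\frac{k}{4}-\frac{1}{2}}\left(\frac{\pi ny}{x^{2}+y^{2}}\right). \end{align*} Moreover, under the same conditions, \begin{align*} \frac{(\pi y)^{\frac{k}{4}-\frac{1}{2}}}{2^{\frac{k}{4}-\frac{1}{2}}\Gamma\left(\frac{k}{4}+\frac{1}{2}\right)}&+\sum_{n=1}^{\infty}\frac{r_{k}(n)}{n^{\frac{k}{4}-\frac{1}{2}}}\,e^{-\pi nx}I_{\frac{k}{4}-\frac{1}{2}}\left(\pi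 ny\right)\\ &=\frac{(\pi y)^{\frac{k}{4}-\frac{1}{2}}}{2^{\frac{k}{4}-\frac{1}{2}}\Gamma\left(\frac{k}{4}+\frac{1}{2}\right)\left(x^{2}-y^{2}\right)^{\frac{k}{4}}}+\frac{1}{\sqrt{x^{2}-y^{2}}}\sum_{n=1}^{\infty}\frac{r_{k}(n)}{n^{\frac{k}{4}-\frac{1}{2}}}\,e^{-\frac{\pi nx}{x^{2}-y^{2}}} I_{\frac{k}{4}-\frac{1}{2}}\left(\frac{\pi ny}{x^{2}-y^{2}}\right). \end{align*}
   Context: $r_k(n)=\#\{(a_1,\dots,a_k)\in\mathbb{Z}^k: a_1^2+\cdots+a_k^2=n\}$. $J_\nu(z)=\sum_{m\ge0}\frac{(-1)^m (z/2)^{2m+\nu}}{m!\,\Gamma(m+\nu+1)}$ and $I_\nu(z)=\sum_{m\ge0}\frac{(z/2)^{2m+\nu}}{m!\,\Gamma(m+\nu+1)}$, with principal powers for positive arguments. *)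

theory Defs
  imports "HOL-Analysis.Analysis"
begin

definition num_sum_squares :: "nat \<Rightarrow> nat \<Rightarrow> nat" where
  "num_sum_squares k n = card {a :: int list. length a = k \<and> (\<Sum>b\<leftarrow>a. b\<^sup>2) = int n}"

text \<open>
  The Bessel functions are meant for real order and positive real argument only: for
  \<open>z \<le> 0\<close> the real power \<open>powr\<close> does not have the intended meaning. At a pole of the Gamma
  function, \<open>Gamma\<close> and hence the quotient are 0, which agrees with the usual convention for
  its reciprocal.
\<close>

definition bessel_J :: "real \<Rightarrow> real \<Rightarrow> real" where
  "bessel_J \<nu> z =
     (\<Sum>m. (-1) ^ m * (z / 2) powr (2 * real m + \<nu>) / (fact m * Gamma (real m + \<nu> + 1)))"

definition bessel_I :: "real \<Rightarrow> real \<Rightarrow> real" where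
  "bessel_I \<nu> z =
     (\<Sum>m. (z / 2) powr (2 * real m + \<nu>) / (fact m * Gamma (real m + \<nu> + 1)))"

end

theory Submission
  imports Defs "HOL-Complex_Analysis.Complex_Analysis" "HOL-Real_Asymp.Real_Asymp"
begin

text \<open>
  Let \<open>\<theta>(z) = \<Sum>n\<in>\<int>. exp (- pi n\<^sup>2 z)\<close>, so that \<open>\<theta>(z)^k = \<Sum>n. r\<^sub>k(n) exp (- pi n z)\<close> and
  \<open>\<theta>(z) = \<theta>(1/z) / sqrt z\<close>. By Poisson's integral for \<open>I\<^sub>\<nu>\<close> with \<open>\<nu> = k/4 - 1/2\<close>, the left-hand
  side of the second identity is a constant multiple of the integral of
  \<open>(1 - s\<^sup>2)^(k/4 - 1) \<theta>(x + y s)^k\<close> over \<open>-1 \<le> s \<le> 1\<close>. The Moebius substitution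
  \<open>t = (x s + y) / (x + y s)\<close> maps \<open>[-1, 1]\<close> to itself, satisfies
  \<open>1 / (x + y s) = (x - y t) / (x\<^sup>2 - y\<^sup>2)\<close>, and turns the weight into itself times precisely the
  power of \<open>x + y s\<close> that the functional equation of \<open>\<theta>\<close> supplies; this gives the identity
  for \<open>I\<^sub>\<nu>\<close>. Divided by \<open>(pi y / 2)^\<nu>\<close>, both sides are holomorphic in \<open>w = y\<^sup>2\<close> near the real
  segment \<open>- x\<^sup>2 < w < x\<^sup>2\<close>, and their values at \<open>w = - y\<^sup>2\<close> are the identity for \<open>J\<^sub>\<nu>\<close>.

  The functional equation of \<open>\<theta>\<close> at real points follows Polya: summing the binomial expansion
  of \<open>(2 cos u)^(2 m)\<close> over the multiples \<open>u\<close> of \<open>pi / l\<close> gives a finite identity that tends to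
  it when \<open>l\<close> grows and \<open>m / l\<^sup>2\<close> converges.
\<close>

subsection \<open>A finite form of the theta functional equation\<close>

text \<open>The factor \<open>sin t\<close> makes the sum telescope through sin A - sin B, and
  keeping it on the left avoids a division at the zeros of the sine.\<close>

lemma dirichlet_kernel:
  fixes t :: real
  shows "sin t * (1 + 2 * (\<Sum>j<h. cos (2 * real (Suc j) * t))) = sin ((2 * real h + 1) * t)"
proof (induction h)
  case (Suc h)
  have "sin ((2 * real (Suc h) + 1) * t) - sin ((2 * real h + 1) * t) = 2 * sin t * cos (2 * real (Suc h) * t)"
    unfolding sin_diff_sin by (rule arg_cong2[of _ _ _ _ "\<lambda>a b. 2 * sin a * cos b"]) (simp_all add: field_simps)
  with Suc show ?case by (simp add: algebra_simps)
qed simp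

text \<open>Orthogonality of characters modulo the odd number l = 2h + 1: the nonzero residues pair
  up as j and -j, so the sum of exp (2 pi sqrt(-1) i j / l) over all residues j becomes 1 plus twice
  a sum of h cosines. It serves as a filter for the multiples of l.\<close>

lemma dirichlet_kernel_lattice:
  fixes i :: int
  shows "1 + 2 * (\<Sum>j<h. cos (2 * of_int i * (pi * real (Suc j) / real (2 * h + 1))))
         = (if int (2 * h + 1) dvd i then real (2 * h + 1) else 0)"
proof (cases "int (2 * h + 1) dvd i")
  case True
  then obtain c where c: "i = int (2 * h + 1) * c" by auto
  have "cos (2 * of_int i * (pi * real (Suc j) / real (2 * h + 1))) = 1" for j
  proof -
    have "2 * of_int i * (pi * real (Suc j) / real (2 * h + 1)) = 2 * pi * of_int (c * int (Suc j))"
      unfolding c by (simp add: field_simps)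
    thus ?thesis by (simp only: cos_int_2pin)
  qed
  with True show ?thesis by simp
next
  case False
  \<comment> \<open>At this angle \<open>sin ((2 * real h + 1) * t)\<close> is the sine of a
    multiple of pi, while \<open>sin t\<close> is nonzero because l does not divide i; the kernel
    therefore vanishes.\<close>
  define t where "t = pi * of_int i / real (2 * h + 1)"
  have "sin ((2 * real h + 1) * t) = sin (pi * of_int i)"
    by (rule arg_cong[of _ _ sin]) (simp add: t_def field_simps)
  hence s0: "sin ((2 * real h + 1) * t) = 0" by (simp add: sin_zero_iff_int2 mult.commute)
  have "sin t \<noteq> 0"
  proof
    assume "sin t = 0"
    then obtain c :: int where "t = of_int c * pi" using sin_zero_iff_int2 by blast
    hence "pi * real_of_int i = pi * of_int (int (2 * h + 1) * c)" by (simp add: t_def field_simps)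
    hence "real_of_int i = of_int (int (2 * h + 1) * c)" by simp
    hence "i = int (2 * h + 1) * c" using of_int_eq_iff by blast
    with False show False by auto
  qed
  moreover have "2 * of_int i * (pi * real (Suc j) / real (2 * h + 1)) = 2 * real (Suc j) * t" for j
    by (simp add: t_def)
  ultimately show ?thesis using dirichlet_kernel[of t h] s0 False by simp
qed

lemma cos_even_power_expansion:
  "4 ^ m * cos t ^ (2 * m) = (\<Sum>i\<le>2 * m. real (2 * m choose i) * cos (2 * of_int (int i - int m) * t))"
proof -
  have "complex_of_real (4 ^ m * cos t ^ (2 * m)) = (cis t + cis (- t)) ^ (2 * m)"
  proof -
    have "cis t + cis (- t) = of_real (2 * cos t)" by (simp add: complex_eq_iff)
    moreover have "(2 * cos t) ^ (2 * m) = 4 ^ m * cos t ^ (2 * m)"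
      by (simp add: power_mult_distrib power_mult)
    ultimately show ?thesis by (metis of_real_power)
  qed
  also have "\<dots> = (\<Sum>i\<le>2 * m. of_nat (2 * m choose i) * cis t ^ i * cis (- t) ^ (2 * m - i))"
    by (rule binomial_ring)
  also have "\<dots> = (\<Sum>i\<le>2 * m. of_nat (2 * m choose i) * cis (2 * of_int (int i - int m) * t))"
  proof (rule sum.cong)
    fix i assume "i \<in> {..2 * m}"
    hence "cis t ^ i * cis (- t) ^ (2 * m - i) = cis (2 * of_int (int i - int m) * t)"
      by (simp add: Complex.DeMoivre cis_mult of_nat_diff algebra_simps)
    thus "of_nat (2 * m choose i) * cis t ^ i * cis (- t) ^ (2 * m - i)
       = of_nat (2 * m choose i) * cis (2 * of_int (int i - int m) * t)" by (simp add: mult.assoc)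
  qed simp
  finally have "Re (complex_of_real (4 ^ m * cos t ^ (2 * m)))
     = Re (\<Sum>i\<le>2 * m. of_nat (2 * m choose i) * cis (2 * of_int (int i - int m) * t))" by simp
  thus ?thesis by (simp only: Re_complex_of_real Re_sum) simp
qed

text \<open>The binomial coefficients are symmetric about m, so the indices above and below m
  contribute equally. The series over r has only finitely many nonzero terms; it is written as a
  series because a limit under an infinite sum will be taken.\<close>

lemma binomial_multisection:
  assumes "l > 0"
  shows "(\<Sum>i\<le>2 * m. if int l dvd int i - int m then real (2 * m choose i) else 0)
         = real (2 * m choose m) + 2 * (\<Sum>r. real (2 * m choose (m + l * Suc r)))"
proof -
  let ?f = "\<lambda>i. if int l dvd int i - int m then real (2 * m choose i) else 0"
  have split: "{..2 * m} = insert m ({..<m} \<union> {m + 1..2 * m})" by auto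
  have up: "(\<Sum>i\<in>{m + 1..2 * m}. ?f i) = (\<Sum>r. real (2 * m choose (m + l * Suc r)))"
  proof -
    have "(\<Sum>r. real (2 * m choose (m + l * Suc r))) = (\<Sum>r | l * Suc r \<le> m. real (2 * m choose (m + l * Suc r)))"
    proof (rule suminf_finite)
      have "{r. l * Suc r \<le> m} \<subseteq> {..m}" 
      proof
        fix r assume "r \<in> {r. l * Suc r \<le> m}"
        moreover have "1 * Suc r \<le> l * Suc r" using assms by (intro mult_le_mono1) simp
        ultimately show "r \<in> {..m}" by simp
      qed
      thus "finite {r. l * Suc r \<le> m}" using finite_subset by blast
    qed (simp add: binomial_eq_0)
    also have "\<dots> = (\<Sum>i\<in>{i \<in> {m + 1..2 * m}. int l dvd int i - int m}. real (2 * m choose i))"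
    proof (rule sum.reindex_bij_witness[where i = "\<lambda>i. (i - m) div l - 1" and j = "\<lambda>r. m + l * Suc r"])
      fix i assume i: "i \<in> {i \<in> {m + 1..2 * m}. int l dvd int i - int m}"
      hence "int l dvd int (i - m)" by (simp add: of_nat_diff)
      hence d: "l dvd i - m" by (simp only: int_dvd_int_iff)
      then obtain q where q: "i - m = l * q" by auto
      \<comment> \<open>Since i > m, the quotient is positive, and the truncated subtraction in the
        inverse map loses nothing.\<close>
      with i assms have "q > 0" by (cases q) auto
      with q assms have e: "Suc ((i - m) div l - 1) = q" by simp
      show "m + l * Suc ((i - m) div l - 1) = i" unfolding e using q i by auto
      have "l * q \<le> m" using q i by auto
      thus "(i - m) div l - 1 \<in> {r. l * Suc r \<le> m}" by (simp only: mem_Collect_eq e)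
    next
      fix r assume r: "r \<in> {r. l * Suc r \<le> m}"
      show "(m + l * Suc r - m) div l - 1 = r" using assms by simp
      have "l * Suc r \<ge> 1" using assms by simp
      moreover have "int (m + l * Suc r) - int m = int l * int (Suc r)" by (simp add: algebra_simps)
      ultimately show "m + l * Suc r \<in> {i \<in> {m + 1..2 * m}. int l dvd int i - int m}" using r
        by (simp del: mult_Suc_right of_nat_Suc of_nat_add of_nat_mult)
    qed simp
    also have "\<dots> = (\<Sum>i\<in>{m + 1..2 * m}. ?f i)" by (intro sum.inter_filter) auto
    finally show ?thesis ..
  qed
  have down: "(\<Sum>i\<in>{..<m}. ?f i) = (\<Sum>i\<in>{m + 1..2 * m}. ?f i)"
  proof (rule sum.reindex_bij_witness[where i = "\<lambda>i. 2 * m - i" and j = "\<lambda>i. 2 * m - i"])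
    fix i assume i: "i \<in> {..<m}"
    hence "int (2 * m - i) - int m = - (int i - int m)" by auto
    hence "int l dvd int (2 * m - i) - int m \<longleftrightarrow> int l dvd int i - int m"
      by (simp only: dvd_minus_iff)
    moreover have "2 * m choose (2 * m - i) = 2 * m choose i"
      using i by (intro binomial_symmetric[symmetric]) auto
    ultimately show "?f (2 * m - i) = ?f i" by simp
  qed auto
  have "(\<Sum>i\<le>2 * m. ?f i) = ?f m + ((\<Sum>i\<in>{..<m}. ?f i) + (\<Sum>i\<in>{m + 1..2 * m}. ?f i))"
    unfolding split by (subst sum.insert; (subst sum.union_disjoint)?) auto
  thus ?thesis unfolding down up by simp
qed

text \<open>Both sides evaluate the sum of (2 cos u)^(2m) over u = pi j / l with j running through
  the residues modulo l. On the left j and l - j are paired; on the right the power is expanded, and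
  only frequencies divisible by l survive the sum over j.\<close>

lemma cos_power_sum_eq_binomial_sum:
  fixes h m :: nat
  defines "l \<equiv> 2 * h + 1"
  shows "4 ^ m * (1 + 2 * (\<Sum>j<h. cos (pi * real (Suc j) / real l) ^ (2 * m)))
       = real l * (real (2 * m choose m) + 2 * (\<Sum>r. real (2 * m choose (m + l * Suc r))))"
proof -
  let ?c = "\<lambda>i j. cos (2 * of_int (int i - int m) * (pi * real (Suc j) / real l))"
  have "(\<Sum>i\<le>2 * m. real (2 * m choose i)) = 4 ^ m"
    using choose_row_sum[of "2 * m"] by (simp add: power_mult flip: of_nat_sum)
  hence "4 ^ m * (1 + 2 * (\<Sum>j<h. cos (pi * real (Suc j) / real l) ^ (2 * m)))
      = (\<Sum>i\<le>2 * m. real (2 * m choose i)) + 2 * (\<Sum>j<h. \<Sum>i\<le>2 * m. real (2 * m choose i) * ?c i j)"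
    by (simp only: cos_even_power_expansion[symmetric] sum_distrib_left[symmetric]) (simp add: algebra_simps)
  also have "\<dots> = (\<Sum>i\<le>2 * m. real (2 * m choose i) * (1 + 2 * (\<Sum>j<h. ?c i j)))"
    by (subst sum.swap) (simp add: sum_distrib_left sum.distrib algebra_simps)
  also have "\<dots> = (\<Sum>i\<le>2 * m. real l * (if int l dvd int i - int m then real (2 * m choose i) else 0))"
    unfolding l_def dirichlet_kernel_lattice by (intro sum.cong) auto
  also have "\<dots> = real l * (real (2 * m choose m) + 2 * (\<Sum>r. real (2 * m choose (m + l * Suc r))))"
    unfolding sum_distrib_left[symmetric] by (subst binomial_multisection) (auto simp: l_def)
  finally show ?thesis .
qed

section \<open>Gaussian estimates for cosines and central binomial coefficients\<close>

lemma cos_le_exp_minus_half_square: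
  assumes "0 \<le> t" "t \<le> pi / 2"
  shows "cos t \<le> exp (- (t\<^sup>2 / 2))"
proof -
  have sin_ge: "u * cos u \<le> sin u" if u: "0 \<le> u" "u \<le> pi / 2" for u :: real
  proof -
    have "sin 0 - 0 * cos 0 \<le> sin u - u * cos u"
    proof (rule DERIV_nonneg_imp_nondecreasing[OF u(1)])
      fix s assume s: "0 \<le> s" "s \<le> u"
      have "((\<lambda>s. sin s - s * cos s) has_real_derivative s * sin s) (at s)"
        by (auto intro!: derivative_eq_intros)
      moreover have "s * sin s \<ge> 0" using s u by (intro mult_nonneg_nonneg sin_ge_zero) auto
      ultimately show "\<exists>y. ((\<lambda>s. sin s - s * cos s) has_real_derivative y) (at s) \<and> 0 \<le> y" by blast
    qed
    thus ?thesis by simp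
  qed
  \<comment> \<open>The product is 1 at the origin, and its derivative has the sign of s cos s - sin
    s, which \<open>sin_ge\<close> controls on the quarter period.\<close>
  have "cos t * exp (t\<^sup>2 / 2) \<le> cos 0 * exp (0\<^sup>2 / 2)"
  proof (rule DERIV_nonpos_imp_nonincreasing[OF assms(1)])
    fix s assume s: "0 \<le> s" "s \<le> t"
    have "((\<lambda>s. cos s * exp (s\<^sup>2 / 2)) has_real_derivative (s * cos s - sin s) * exp (s\<^sup>2 / 2)) (at s)"
      by (auto intro!: derivative_eq_intros simp: algebra_simps)
    moreover have "(s * cos s - sin s) * exp (s\<^sup>2 / 2) \<le> 0"
      using sin_ge[of s] s assms by (intro mult_nonpos_nonneg) auto
    ultimately show "\<exists>y. ((\<lambda>s. cos s * exp (s\<^sup>2 / 2)) has_real_derivative y) (at s) \<and> y \<le> 0" by blast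
  qed
  thus ?thesis by (simp add: exp_minus field_simps)
qed

lemma central_binomial_step:
  assumes "b < m"
  shows "real (2 * m choose (m + Suc b)) = real (2 * m choose (m + b)) * (real (m - b) / real (m + b + 1))"
proof -
  have "Suc (m + b) * (2 * m choose Suc (m + b)) = (2 * m - (m + b)) * (2 * m choose (m + b))"
    using binomial_absorption[of "m + b" "2 * m"] binomial_absorb_comp[of "2 * m" "m + b"] by simp
  also have "2 * m - (m + b) = m - b" by simp
  finally have "real (Suc (m + b)) * real (2 * m choose Suc (m + b)) = real (m - b) * real (2 * m choose (m + b))"
    by (simp only: of_nat_mult [symmetric])
  thus ?thesis by (simp add: field_simps)
qed

text \<open>The ratio of the two binomials is the product of 1 - (2i + 1) / (m + i + 1) over i < b.
  Replacing each denominator by the larger m + A and using 1 - u <= exp (- u) leaves the sum of the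
  first b odd numbers, b^2, in the exponent.\<close>

lemma central_binomial_ratio_le:
  assumes "b \<le> A" "A \<le> m"
  shows "real (2 * m choose (m + b)) \<le> real (2 * m choose m) * exp (- (real b ^ 2 / real (m + A)))"
  using assms(1)
proof (induction b)
  case (Suc b)
  have "b < m" using Suc assms by simp
  have "real (m - b) / real (m + b + 1) = 1 - (2 * real b + 1) / real (m + b + 1)"
    using \<open>b < m\<close> by (simp add: field_simps of_nat_diff)
  also have "\<dots> \<le> 1 - (2 * real b + 1) / real (m + A)"
    using Suc by (intro diff_left_mono divide_left_mono) auto
  also have "\<dots> \<le> exp (- ((2 * real b + 1) / real (m + A)))"
    using exp_ge_add_one_self[of "- ((2 * real b + 1) / real (m + A))"] by simp
  finally have "real (2 * m choose (m + Suc b)) \<le>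
     real (2 * m choose m) * exp (- (real b ^ 2 / real (m + A))) * exp (- ((2 * real b + 1) / real (m + A)))"
    unfolding central_binomial_step[OF \<open>b < m\<close>] using Suc by (intro mult_mono) auto
  also have "\<dots> = real (2 * m choose m) * exp (- (real (Suc b) ^ 2 / real (m + A)))"
    by (simp add: mult.assoc exp_add[symmetric] add_divide_distrib[symmetric] power2_eq_square algebra_simps)
  finally show ?case .
qed simp

text \<open>The same product is inverted first: its reciprocal has factors 1 + (2i + 1) / (m - i),
  so that 1 + u <= exp u again bounds in the right direction, now with the smaller denominator m -
  A.\<close>

lemma central_binomial_ratio_ge:
  assumes "b \<le> A" "A < m"
  shows "real (2 * m choose m) * exp (- (real b ^ 2 / real (m - A))) \<le> real (2 * m choose (m + b))"
  using assms(1)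
proof (induction b)
  case (Suc b)
  have "b < m" using Suc assms by simp
  have "real (m + b + 1) / real (m - b) = 1 + (2 * real b + 1) / real (m - b)"
    using \<open>b < m\<close> by (simp add: field_simps of_nat_diff)
  also have "\<dots> \<le> 1 + (2 * real b + 1) / real (m - A)"
    using Suc assms by (intro add_left_mono divide_left_mono) auto
  also have "\<dots> \<le> exp ((2 * real b + 1) / real (m - A))"
    by (rule exp_ge_add_one_self)
  finally have "exp (- ((2 * real b + 1) / real (m - A))) \<le> real (m - b) / real (m + b + 1)"
    using \<open>b < m\<close> by (simp add: exp_minus field_simps)
  hence "real (2 * m choose m) * exp (- (real b ^ 2 / real (m - A))) * exp (- ((2 * real b + 1) / real (m - A)))
     \<le> real (2 * m choose (m + Suc b))"
    unfolding central_binomial_step[OF \<open>b < m\<close>] using Suc by (intro mult_mono) auto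
  moreover have "real (2 * m choose m) * exp (- (real b ^ 2 / real (m - A))) * exp (- ((2 * real b + 1) / real (m - A))) = real (2 * m choose m) * exp (- (real (Suc b) ^ 2 / real (m - A)))"
    by (simp add: mult.assoc exp_add[symmetric] add_divide_distrib[symmetric] power2_eq_square algebra_simps)
  ultimately show ?case by simp
qed simp

text \<open>The quotient of the central binomial by 4^n is, up to the sign (-1)^n, the generalized
  binomial of -1/2 over n, whose asymptotics have the constant 1 / Gamma(1/2).\<close>

lemma central_binomial_tendsto:
  "(\<lambda>n. sqrt (real n) * real (2 * n choose n) / 4 ^ n) \<longlonglongrightarrow> 1 / sqrt pi"
proof -
  have "(\<lambda>n. (-1/2 gchoose n) / ((-1) ^ n / exp ((-1/2 + 1) * of_real (ln (real n))))) \<longlonglongrightarrow> inverse (Gamma (1/2 :: real))"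
    using gbinomial_asymptotic[of "-1/2 :: real"] by simp
  hence "(\<lambda>n. (-1/2 gchoose n) / ((-1) ^ n / exp ((-1/2 + 1) * of_real (ln (real n))))) \<longlonglongrightarrow> 1 / sqrt pi"
    by (simp only: Gamma_one_half_real inverse_eq_divide)
  moreover have "eventually (\<lambda>n. (-1/2 gchoose n) / ((-1) ^ n / exp ((-1/2 + 1) * of_real (ln (real n))))
     = sqrt (real n) * real (2 * n choose n) / 4 ^ n) sequentially"
    using eventually_gt_at_top[of 0]
  proof eventually_elim
    case (elim n)
    have "real (2 * n choose n) = fact (2 * n) / (fact n * fact n)"
      using binomial_fact[of n "2 * n", where ?'a = real] by simp
    also have "\<dots> = 4 ^ n * pochhammer (1/2) n / fact n"
      by (simp add: fact_double power_mult)
    finally have "pochhammer (1/2) n / fact n = real (2 * n choose n) / 4 ^ n" by simp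
    hence "(-1/2 gchoose n) = (-1) ^ n * (real (2 * n choose n) / 4 ^ n)"
      unfolding gbinomial_pochhammer by (simp add: mult.assoc times_divide_eq_right[symmetric] del: times_divide_eq_right)
    moreover have "exp ((-1/2 + 1) * of_real (ln (real n))) = sqrt (real n)"
      using elim by (simp add: powr_half_sqrt[symmetric] powr_def)
    ultimately show ?case by simp
  qed
  ultimately show ?thesis by (rule Lim_transform_eventually)
qed

subsection \<open>The theta functional equation\<close>

text \<open>The two-sided theta series folded at 0, which is the shape in which the finite identity
  tends to it; the sum over all integers is recovered in
  \<open>exp_minus_square_has_sum_int\<close>.\<close>

definition jtheta :: "real \<Rightarrow> real" where
  "jtheta x = 1 + 2 * (\<Sum>n. exp (- pi * x * real (Suc n) ^ 2))"

text \<open>Tannery's theorem asks for its majorant along a product filter; the majorants below hold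
  for all summation indices at once.\<close>

lemma eventually_prod_const:
  assumes "eventually (\<lambda>n. \<forall>k. P k n) F"
  shows "eventually (\<lambda>(k, n). P k n) (G \<times>\<^sub>F F)"
  using eventually_prodI[OF always_eventually assms, of "\<lambda>_. True" G]
  by (rule eventually_mono) auto

text \<open>The finite identity is divided by 4^m, and both series pass to the limit by Tannery's
  theorem while m grows like c l^2.\<close>

theorem jtheta_inversion:
  assumes x: "x > 0"
  shows "jtheta x = jtheta (1 / x) / sqrt x"
proof -
  \<comment> \<open>The power cos (pi j / l)^(2m) behaves like exp (- pi^2 j^2 m / l^2), so m / l^2
    must tend to x / pi to give exp (- pi x j^2). The binomial ratios then tend to exp (- r^2 / c) =
    exp (- pi r^2 / x).\<close>
  define c where "c = x / pi"
  have c: "c > 0" using x by (simp add: c_def)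
  define l :: "nat \<Rightarrow> nat" where "l = (\<lambda>n. 2 * n + 1)"
  define m :: "nat \<Rightarrow> nat" where "m = (\<lambda>n. nat \<lfloor>c * real (l n) ^ 2\<rfloor>)"
  have l_pos: "real (l n) > 0" for n by (simp add: l_def)
  have m_le: "real (m n) \<le> c * real (l n) ^ 2" and m_ge: "real (m n) \<ge> c * real (l n) ^ 2 - 1" for n
    using c by (auto simp: m_def)
  have ml: "(\<lambda>n. real (m n) / real (l n) ^ 2) \<longlonglongrightarrow> c"
  proof (rule tendsto_sandwich)
    show "(\<lambda>n. c - 1 / real (l n) ^ 2) \<longlonglongrightarrow> c"
      unfolding l_def by real_asymp
    show "eventually (\<lambda>n. c - 1 / real (l n) ^ 2 \<le> real (m n) / real (l n) ^ 2) sequentially"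
    proof (intro always_eventually allI)
      fix n
      have "c - 1 / real (l n) ^ 2 = (c * real (l n) ^ 2 - 1) / real (l n) ^ 2"
        using l_pos[of n] by (simp add: field_simps)
      thus "c - 1 / real (l n) ^ 2 \<le> real (m n) / real (l n) ^ 2"
        using m_ge[of n] by (simp add: divide_right_mono)
    qed
    show "eventually (\<lambda>n. real (m n) / real (l n) ^ 2 \<le> c) sequentially"
      using m_le l_pos by (intro always_eventually allI) (simp add: field_simps)
  qed simp_all
  have l_top: "filterlim (\<lambda>n. real (l n)) at_top sequentially"
    unfolding l_def by real_asymp
  have m_top: "filterlim m sequentially sequentially"
  proof -
    have "filterlim (\<lambda>n. c * real (l n) ^ 2 - 1) at_top sequentially"
      unfolding l_def using c by real_asymp
    hence "filterlim (\<lambda>n. real (m n)) at_top sequentially"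
      by (rule filterlim_at_top_mono) (use m_ge in auto)
    thus ?thesis using filterlim_sequentially_iff_filterlim_real by blast
  qed
  have ev_half: "eventually (\<lambda>n. c / 2 < real (m n) / real (l n) ^ 2) sequentially"
    using ml c by (intro order_tendstoD) auto

  \<comment> \<open>Padding with zeros for j >= n turns the finite cosine sum with h = n into a
    series.\<close>
  define a where "a = (\<lambda>j n. if j < n then cos (pi * real (Suc j) / real (l n)) ^ (2 * m n) else 0)"
  have t_less: "pi * real (Suc j) / real (l n) < pi / 2" if "j < n" for j n
    using that by (simp add: l_def field_simps del: of_nat_Suc) (simp add: algebra_simps)
  have a_lim: "(\<lambda>n. a j n) \<longlonglongrightarrow> exp (- pi * x * real (Suc j) ^ 2)" for j
  proof -
    define t where "t = (\<lambda>n. pi * real (Suc j) / real (l n))"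
    have t_pos: "t n > 0" for n using l_pos by (simp add: t_def)
    have "((\<lambda>t::real. ln (cos t) / t ^ 2) \<longlongrightarrow> - 1 / 2) (at_right 0)" by real_asymp
    moreover have "filterlim t (at_right 0) sequentially"
      unfolding t_def l_def by real_asymp
    ultimately have "(\<lambda>n. ln (cos (t n)) / t n ^ 2) \<longlonglongrightarrow> - 1 / 2" by (rule filterlim_compose)
    hence "(\<lambda>n. exp (2 * (real (m n) / real (l n) ^ 2) * (pi * real (Suc j)) ^ 2 * (ln (cos (t n)) / t n ^ 2)))
        \<longlonglongrightarrow> exp (2 * c * (pi * real (Suc j)) ^ 2 * (- 1 / 2))"
      using ml by (intro tendsto_exp tendsto_mult tendsto_const)
    also have "2 * c * (pi * real (Suc j)) ^ 2 * (- 1 / 2) = - pi * x * real (Suc j) ^ 2"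
      by (simp add: c_def power2_eq_square field_simps)
    finally show ?thesis
    proof (rule Lim_transform_eventually)
      show "eventually (\<lambda>n. exp (2 * (real (m n) / real (l n) ^ 2) * (pi * real (Suc j)) ^ 2 * (ln (cos (t n)) / t n ^ 2)) = a j n) sequentially"
        using eventually_gt_at_top[of j]
      proof eventually_elim
        case (elim n)
        have "cos (t n) > 0" using t_less[OF elim] t_pos[of n] by (intro cos_gt_zero_pi) (auto simp: t_def)
        moreover have "2 * (real (m n) / real (l n) ^ 2) * (pi * real (Suc j)) ^ 2 * (ln (cos (t n)) / t n ^ 2)
           = real (2 * m n) * ln (cos (t n))"
          using l_pos[of n] by (simp add: t_def power_divide power_mult_distrib)
        ultimately show ?case using elim
          by (simp only: exp_of_nat_mult) (simp add: a_def t_def)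
      qed
    qed
  qed
  \<comment> \<open>A geometric majorant independent of n: the Gaussian bound for the cosine is
    combined with m / l^2 > c / 2 and with pi^2 (j + 1)^2 >= j + 1.\<close>
  have a_bound: "norm (a j n) \<le> exp (- (c / 2)) ^ Suc j" if n: "c / 2 < real (m n) / real (l n) ^ 2" for j n
  proof (cases "j < n")
    case True
    define t where "t = pi * real (Suc j) / real (l n)"
    have t: "0 \<le> t" "t \<le> pi / 2" using t_less[OF True] by (auto simp: t_def)
    have "cos t ^ (2 * m n) \<le> exp (- (t ^ 2 / 2)) ^ (2 * m n)"
      using cos_le_exp_minus_half_square[OF t] cos_ge_zero[of t] t by (intro power_mono) auto
    also have "\<dots> = exp (- (real (m n) * t ^ 2))"
      by (simp add: exp_of_nat_mult[symmetric])
    also have "real (m n) * t ^ 2 = (real (m n) / real (l n) ^ 2) * (pi * real (Suc j)) ^ 2"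
      by (simp add: t_def power_divide)
    finally have "cos t ^ (2 * m n) \<le> exp (- (real (m n) / real (l n) ^ 2 * (pi * real (Suc j)) ^ 2))" .
    moreover have "(c / 2) * real (Suc j) \<le> (real (m n) / real (l n) ^ 2) * (pi * real (Suc j)) ^ 2"
    proof (intro mult_mono)
      have "real (Suc j) * 1 \<le> real (Suc j) * (real (Suc j) * pi ^ 2)"
      proof (rule mult_left_mono)
        have "1 * 1 \<le> real (Suc j) * pi ^ 2"
          using pi_ge_two by (intro mult_mono) (auto intro: one_le_power)
        thus "1 \<le> real (Suc j) * pi ^ 2" by simp
      qed simp
      thus "real (Suc j) \<le> (pi * real (Suc j)) ^ 2" by (simp add: power2_eq_square algebra_simps)
    qed (use n c in auto)
    ultimately have "cos t ^ (2 * m n) \<le> exp (- ((c / 2) * real (Suc j)))"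
      by (meson exp_le_cancel_iff le_imp_neg_le order_trans)
    also have "\<dots> = exp (- (c / 2)) ^ Suc j" by (simp only: exp_of_nat_mult[symmetric]) (simp add: algebra_simps)
    finally have "cos t ^ (2 * m n) \<le> exp (- (c / 2)) ^ Suc j" .
    thus ?thesis using True by (simp add: a_def t_def)
  qed (auto simp: a_def)
  have sum_a: "(\<lambda>n. \<Sum>j. a j n) \<longlonglongrightarrow> (\<Sum>j. exp (- pi * x * real (Suc j) ^ 2))"
  proof (rule tannerys_theorem[THEN conjunct2, THEN conjunct2])
    show "eventually (\<lambda>(j, n). norm (a j n) \<le> exp (- (c / 2)) ^ Suc j) (at_top \<times>\<^sub>F sequentially)"
      by (rule eventually_prod_const) (use ev_half a_bound in \<open>auto elim: eventually_mono\<close>)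
    show "summable (\<lambda>j. exp (- (c / 2)) ^ Suc j)" using c by (simp add: summable_geometric)
  qed (use a_lim in auto)

  define b where "b = (\<lambda>r n. real (2 * m n choose (m n + l n * Suc r)) / real (2 * m n choose m n))"
  have C_pos: "real (2 * k choose k) > 0" for k by simp
  have b_lim: "(\<lambda>n. b r n) \<longlonglongrightarrow> exp (- pi * (1 / x) * real (Suc r) ^ 2)" for r
  proof -
    define A where "A = (\<lambda>n. l n * Suc r)"
    have q: "(\<lambda>n. real (Suc r) / real (l n)) \<longlonglongrightarrow> 0"
      unfolding l_def by real_asymp
    \<comment> \<open>The sign s = 1 or -1 selects the upper or lower binomial estimate, with
      denominator m + A or m - A. As A is of order l and m of order l^2, both exponents have the
      same limit.\<close>
    have lim: "(\<lambda>n. exp (- (real (Suc r) ^ 2 / (real (m n) / real (l n) ^ 2 + s * (real (Suc r) / real (l n))))))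
          \<longlonglongrightarrow> exp (- (real (Suc r) ^ 2 / (c + s * 0)))" for s
      using c ml q by (intro tendsto_intros) auto
    have c0: "exp (- (real (Suc r) ^ 2 / (c + s * 0))) = exp (- pi * (1 / x) * real (Suc r) ^ 2)" for s :: real
      using x by (simp add: c_def)
    have ev: "eventually (\<lambda>n. A n < m n) sequentially"
    proof -
      have "eventually (\<lambda>n. real (Suc r) / real (l n) < c / 2) sequentially"
        using q c by (intro order_tendstoD) auto
      with ev_half show ?thesis
      proof eventually_elim
        case (elim n)
        hence "real (Suc r) / real (l n) < real (m n) / real (l n) ^ 2" by (rule less_trans[rotated])
        hence "real (Suc r) / real (l n) * real (l n) ^ 2 < real (m n)"
          using l_pos[of n] by (simp only: pos_less_divide_eq zero_less_power)
        hence "real (Suc r * l n) < real (m n)"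
          using l_pos[of n] by (simp add: power2_eq_square del: of_nat_Suc mult_Suc)
        thus ?case by (simp only: A_def of_nat_less_iff mult.commute)
      qed
    qed
    have rescale: "(L * R) ^ 2 / (M + s * (L * R)) = R ^ 2 / (M / L ^ 2 + s * (R / L))" if "L > 0" for L R M s :: real
    proof -
      have "M / L ^ 2 + s * (R / L) = (M + s * (L * R)) / L ^ 2"
        using that by (simp add: field_simps power2_eq_square)
      thus ?thesis using that by (simp add: power_mult_distrib)
    qed
    have b_eq: "b r n = real (2 * m n choose (m n + A n)) / real (2 * m n choose m n)" for n
      by (simp only: b_def A_def)
    have A_eq: "real (A n) = real (l n) * real (Suc r)" for n by (simp only: A_def of_nat_mult)
    have rw: "real (A n) ^ 2 / (real (m n) + s * real (A n))
        = real (Suc r) ^ 2 / (real (m n) / real (l n) ^ 2 + s * (real (Suc r) / real (l n)))" for n s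
      unfolding A_eq by (rule rescale[OF l_pos])
    show ?thesis
    proof (rule tendsto_sandwich)
      show "(\<lambda>n. exp (- (real (A n) ^ 2 / (real (m n) + (-1) * real (A n))))) \<longlonglongrightarrow> exp (- pi * (1 / x) * real (Suc r) ^ 2)"
        using lim[of "-1"] unfolding rw c0 .
      show "(\<lambda>n. exp (- (real (A n) ^ 2 / (real (m n) + 1 * real (A n))))) \<longlonglongrightarrow> exp (- pi * (1 / x) * real (Suc r) ^ 2)"
        using lim[of 1] unfolding rw c0 .
      show "eventually (\<lambda>n. exp (- (real (A n) ^ 2 / (real (m n) + (-1) * real (A n)))) \<le> b r n) sequentially"
        using ev
      proof eventually_elim
        case (elim n)
        thus ?case using central_binomial_ratio_ge[of "A n" "A n" "m n"] C_pos[of "m n"]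
          by (simp add: b_eq field_simps of_nat_diff)
      qed
      show "eventually (\<lambda>n. b r n \<le> exp (- (real (A n) ^ 2 / (real (m n) + 1 * real (A n))))) sequentially"
        using ev
      proof eventually_elim
        case (elim n)
        thus ?case using central_binomial_ratio_le[of "A n" "A n" "m n"] C_pos[of "m n"]
          by (simp add: b_eq field_simps)
      qed
    qed
  qed
  \<comment> \<open>If l (r + 1) exceeds m, the binomial coefficient is 0. Otherwise the denominator
    m + A is at most 2m, hence at most 2 c l^2.\<close>
  have b_bound: "norm (b r n) \<le> exp (- (1 / (2 * c))) ^ Suc r" for r n
  proof (cases "l n * Suc r \<le> m n")
    case True
    define A where "A = l n * Suc r"
    have b_eq: "b r n = real (2 * m n choose (m n + A)) / real (2 * m n choose m n)"
      by (simp only: b_def A_def)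
    have A: "A \<le> m n" "A > 0" using True by (auto simp: A_def l_def)
    have "b r n \<le> exp (- (real A ^ 2 / real (m n + A)))"
      using central_binomial_ratio_le[of A A "m n"] A C_pos[of "m n"]
      by (simp add: b_eq field_simps)
    moreover have "(1 / (2 * c)) * real (Suc r) \<le> real A ^ 2 / real (m n + A)"
    proof -
      have "real (m n + A) \<le> 2 * c * real (l n) ^ 2" using m_le[of n] A by simp
      hence "real A ^ 2 / (2 * c * real (l n) ^ 2) \<le> real A ^ 2 / real (m n + A)"
        using A l_pos[of n] c by (intro divide_left_mono) auto
      moreover have "real A ^ 2 / (2 * c * real (l n) ^ 2) = (1 / (2 * c)) * real (Suc r) ^ 2"
      proof -
        have "real A ^ 2 = real (l n) ^ 2 * real (Suc r) ^ 2" by (simp only: A_def of_nat_mult power_mult_distrib)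
        thus ?thesis using l_pos[of n] c by simp
      qed
      moreover have "(1 / (2 * c)) * real (Suc r) \<le> (1 / (2 * c)) * real (Suc r) ^ 2"
        using c by (intro mult_left_mono self_le_power) auto
      ultimately show ?thesis by linarith
    qed
    ultimately have "b r n \<le> exp (- ((1 / (2 * c)) * real (Suc r)))"
      by (meson exp_le_cancel_iff le_imp_neg_le order_trans)
    also have "\<dots> = exp (- (1 / (2 * c))) ^ Suc r" by (simp only: exp_of_nat_mult[symmetric]) (simp add: algebra_simps)
    finally show ?thesis by (simp add: b_def)
  qed (auto simp: b_def binomial_eq_0)
  have sum_b: "(\<lambda>n. \<Sum>r. b r n) \<longlonglongrightarrow> (\<Sum>r. exp (- pi * (1 / x) * real (Suc r) ^ 2))"
  proof (rule tannerys_theorem[THEN conjunct2, THEN conjunct2])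
    show "eventually (\<lambda>(r, n). norm (b r n) \<le> exp (- (1 / (2 * c))) ^ Suc r) (at_top \<times>\<^sub>F sequentially)"
      by (rule eventually_prod_const) (use b_bound in auto)
    show "summable (\<lambda>r. exp (- (1 / (2 * c))) ^ Suc r)" using c by (simp add: summable_geometric)
  qed (use b_lim in auto)

  \<comment> \<open>Write l as sqrt m divided by sqrt (m / l^2); then the central binomial limit
    applies along m, and sqrt c * sqrt pi = sqrt x.\<close>
  have pref: "(\<lambda>n. real (l n) * real (2 * m n choose m n) / 4 ^ m n) \<longlonglongrightarrow> 1 / sqrt x"
  proof -
    have "(\<lambda>n. (1 / sqrt (real (m n) / real (l n) ^ 2)) * (sqrt (real (m n)) * real (2 * m n choose m n) / 4 ^ m n))
        \<longlonglongrightarrow> (1 / sqrt c) * (1 / sqrt pi)"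
      using c by (intro tendsto_mult tendsto_divide tendsto_real_sqrt ml tendsto_const
          filterlim_compose[OF central_binomial_tendsto m_top]) auto
    also have "(1 / sqrt c) * (1 / sqrt pi) = 1 / sqrt x"
      by (simp add: c_def real_sqrt_divide)
    finally show ?thesis
    proof (rule Lim_transform_eventually)
      show "eventually (\<lambda>n. (1 / sqrt (real (m n) / real (l n) ^ 2)) * (sqrt (real (m n)) * real (2 * m n choose m n) / 4 ^ m n)
         = real (l n) * real (2 * m n choose m n) / 4 ^ m n) sequentially"
        using ev_half
      proof eventually_elim
        case (elim n)
        hence "real (m n) > 0" using c by (cases "m n = 0") auto
        thus ?case using l_pos[of n] by (simp add: real_sqrt_divide)
      qed
    qed
  qed
  have "1 + 2 * (\<Sum>j. a j n) = (real (l n) * real (2 * m n choose m n) / 4 ^ m n) * (1 + 2 * (\<Sum>r. b r n))" for n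
  proof -
    have "(\<Sum>j. a j n) = (\<Sum>j<n. a j n)" by (rule suminf_finite) (auto simp: a_def)
    hence sa: "(\<Sum>j. a j n) = (\<Sum>j<n. cos (pi * real (Suc j) / real (l n)) ^ (2 * m n))" by (simp add: a_def)
    have "summable (\<lambda>r. b r n)"
      by (rule summable_comparison_test[of _ "\<lambda>r. exp (- (1 / (2 * c))) ^ Suc r"])
        (use b_bound c in \<open>auto simp: summable_geometric\<close>)
    hence "(\<Sum>r. real (2 * m n choose m n) * b r n) = real (2 * m n choose m n) * (\<Sum>r. b r n)"
      by (rule suminf_mult)
    moreover have "real (2 * m n choose m n) * b r n = real (2 * m n choose (m n + l n * Suc r))" for r
      by (simp add: b_def)
    ultimately have sb: "(\<Sum>r. real (2 * m n choose (m n + l n * Suc r))) = real (2 * m n choose m n) * (\<Sum>r. b r n)"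
      by simp
    show ?thesis
      using cos_power_sum_eq_binomial_sum[of "m n" n] unfolding l_def[THEN fun_cong, symmetric] sa[symmetric] sb
      by (simp add: field_simps)
  qed
  moreover have "(\<lambda>n. 1 + 2 * (\<Sum>j. a j n)) \<longlonglongrightarrow> jtheta x"
    unfolding jtheta_def by (intro tendsto_intros sum_a)
  moreover have "(\<lambda>n. (real (l n) * real (2 * m n choose m n) / 4 ^ m n) * (1 + 2 * (\<Sum>r. b r n))) \<longlonglongrightarrow> 1 / sqrt x * jtheta (1 / x)"
    unfolding jtheta_def by (intro tendsto_intros sum_b pref)
  ultimately show ?thesis using LIMSEQ_unique by force
qed

subsection \<open>Powers of the theta function and sums of squares\<close>

text \<open>Unordered summation is chosen so that k copies can be multiplied and then regrouped by
  the value of the sum of squares.\<close>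

lemma exp_minus_square_has_sum_int:
  assumes x: "x > 0"
  shows "((\<lambda>a::int. exp (- pi * x * of_int (a\<^sup>2))) has_sum jtheta x) UNIV"
proof -
  let ?g = "\<lambda>n. exp (- pi * x * real (Suc n) ^ 2)"
  have s: "summable ?g"
  proof (rule summable_comparison_test)
    show "\<exists>N. \<forall>n\<ge>N. norm (?g n) \<le> exp (- pi * x) ^ Suc n"
    proof (intro exI allI impI)
      fix n :: nat
      have "real (Suc n) \<le> real (Suc n) ^ 2" by (intro self_le_power) auto
      hence "pi * x * real (Suc n) \<le> pi * x * real (Suc n) ^ 2" using x by (intro mult_left_mono) auto
      thus "norm (?g n) \<le> exp (- pi * x) ^ Suc n"
        by (simp only: exp_of_nat_mult[symmetric]) (simp add: algebra_simps)
    qed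
    show "summable (\<lambda>n. exp (- pi * x) ^ Suc n)" using x by (simp add: summable_geometric)
  qed
  define S where "S = suminf ?g"
  have nat_sum: "(?g has_sum S) UNIV"
    unfolding S_def using s by (intro norm_summable_imp_has_sum) (auto intro: summable_sums)
  have pos: "((\<lambda>a::int. exp (- pi * x * of_int (a\<^sup>2))) has_sum S) {0<..}"
    using nat_sum
    by (subst has_sum_reindex_bij_witness[of _ "\<lambda>n. int (Suc n)" "\<lambda>a. nat a - 1" UNIV ?g]) auto
  have neg: "((\<lambda>a::int. exp (- pi * x * of_int (a\<^sup>2))) has_sum S) {..<0}"
    using pos
    by (subst has_sum_reindex_bij_witness[of _ uminus uminus "{0<..}" "\<lambda>a::int. exp (- pi * x * of_int (a\<^sup>2))"]) auto
  have zero: "((\<lambda>a::int. exp (- pi * x * of_int (a\<^sup>2))) has_sum 1) {0}"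
    using has_sum_finite[of "{0::int}" "\<lambda>a::int. exp (- pi * x * of_int (a\<^sup>2))"] by simp
  have "((\<lambda>a::int. exp (- pi * x * of_int (a\<^sup>2))) has_sum (1 + S + S)) ({0} \<union> {0<..} \<union> {..<0})"
    by (intro has_sum_Un_disjoint pos neg zero) auto
  also have "{0} \<union> {0<..} \<union> {..<0} = (UNIV :: int set)" by auto
  also have "1 + S + S = jtheta x" by (simp add: jtheta_def S_def)
  finally show ?thesis .
qed

text \<open>Splitting a list into head and tail factors the exponential, so one more entry
  contributes one more factor \<open>jtheta x\<close>.\<close>

lemma jtheta_power_has_sum_lists:
  assumes x: "x > 0"
  shows "((\<lambda>a. exp (- pi * x * of_int (\<Sum>b\<leftarrow>a. b\<^sup>2))) has_sum jtheta x ^ k) {a :: int list. length a = k}"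
proof (induction k)
  case 0
  have "{a :: int list. length a = 0} = {[]}" by auto
  thus ?case using has_sum_finite[of "{[]} :: int list set" "\<lambda>a. exp (- pi * x * of_int (\<Sum>b\<leftarrow>a. b\<^sup>2))"] by simp
next
  case (Suc k)
  let ?L = "\<lambda>k. {a :: int list. length a = k}"
  let ?f = "\<lambda>(b, a). exp (- pi * x * of_int (b\<^sup>2)) * exp (- pi * x * of_int (\<Sum>b\<leftarrow>a. b\<^sup>2))"
  have "(?f has_sum (jtheta x * jtheta x ^ k)) (UNIV \<times> ?L k)"
  proof (rule has_sum_SigmaI)
    show "((\<lambda>a. ?f (b, a)) has_sum (exp (- pi * x * of_int (b\<^sup>2)) * jtheta x ^ k)) (?L k)" for b
      using has_sum_cmult_right[OF Suc] by simp
    show "((\<lambda>b::int. exp (- pi * x * of_int (b\<^sup>2)) * jtheta x ^ k) has_sum (jtheta x * jtheta x ^ k)) UNIV"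
      by (intro has_sum_cmult_left exp_minus_square_has_sum_int x)
    show "?f summable_on (UNIV \<times> ?L k)"
    proof (rule summable_on_SigmaI)
      show "((\<lambda>a. ?f (b, a)) has_sum (exp (- pi * x * of_int (b\<^sup>2)) * jtheta x ^ k)) (?L k)" for b
        using has_sum_cmult_right[OF Suc] by simp
      show "(\<lambda>b::int. exp (- pi * x * of_int (b\<^sup>2)) * jtheta x ^ k) summable_on UNIV"
        using has_sum_imp_summable[OF has_sum_cmult_left[OF exp_minus_square_has_sum_int[OF x]]] .
    qed auto
  qed
  moreover have "(?f has_sum (jtheta x * jtheta x ^ k)) (UNIV \<times> ?L k)
     \<longleftrightarrow> ((\<lambda>a. exp (- pi * x * of_int (\<Sum>b\<leftarrow>a. b\<^sup>2))) has_sum jtheta x ^ Suc k) (?L (Suc k))"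
  proof (rule has_sum_reindex_bij_witness[where i = "\<lambda>a. (hd a, tl a)" and j = "\<lambda>(b, a). b # a"])
    fix a :: "int list" assume "a \<in> ?L (Suc k)"
    thus "(case (hd a, tl a) of (b, a) \<Rightarrow> b # a) = a" by (cases a) auto
    show "(hd a, tl a) \<in> UNIV \<times> ?L k" using \<open>a \<in> ?L (Suc k)\<close> by simp
  next
    fix p :: "int \<times> int list"
    obtain b a where p: "p = (b, a)" by (cases p)
    show "exp (- pi * x * of_int (\<Sum>b\<leftarrow>(case p of (b, a) \<Rightarrow> b # a). b\<^sup>2)) = ?f p"
      by (simp add: p exp_add[symmetric] algebra_simps)
  qed auto
  ultimately show ?case by blast
qed

text \<open>Every entry is bounded by its square, hence by n. Finiteness matters because
  \<open>card\<close> is 0 on infinite sets.\<close>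

lemma finite_sum_squares_eq: "finite {a :: int list. length a = k \<and> (\<Sum>b\<leftarrow>a. b\<^sup>2) = int n}"
proof (rule finite_subset)
  show "finite {a :: int list. set a \<subseteq> {- int n..int n} \<and> length a = k}"
    by (rule finite_lists_length_eq) simp
  show "{a :: int list. length a = k \<and> (\<Sum>b\<leftarrow>a. b\<^sup>2) = int n} \<subseteq> {a. set a \<subseteq> {- int n..int n} \<and> length a = k}"
  proof safe
    fix a :: "int list" and b assume a: "(\<Sum>b\<leftarrow>a. b\<^sup>2) = int n" and b: "b \<in> set a"
    have "\<bar>b\<bar> \<le> b\<^sup>2"
    proof (cases "b = 0")
      case False
      hence "\<bar>b\<bar> * 1 \<le> \<bar>b\<bar> * \<bar>b\<bar>" by (intro mult_left_mono) auto
      thus ?thesis by (simp add: power2_eq_square flip: abs_mult)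
    qed simp
    also have "b\<^sup>2 \<le> (\<Sum>b\<leftarrow>a. b\<^sup>2)" using b by (intro member_le_sum_list) auto
    finally have "\<bar>b\<bar> \<le> int n" using a by simp
    thus "b \<in> {- int n..int n}" by auto
  qed
qed

text \<open>The lattice points are indexed by pairs (n, a) with a on the sphere of squared radius n;
  each fibre is finite and contributes its cardinality times a constant.\<close>

lemma jtheta_power_sums:
  assumes x: "x > 0"
  shows "(\<lambda>n. real (num_sum_squares k n) * exp (- pi * x * real n)) sums (jtheta x ^ k)"
proof -
  let ?A = "\<lambda>n. {a :: int list. length a = k \<and> (\<Sum>b\<leftarrow>a. b\<^sup>2) = int n}"
  let ?f = "\<lambda>(n::nat, a::int list). exp (- pi * x * real n)"
  have nn: "(\<Sum>b\<leftarrow>a. b\<^sup>2) \<ge> 0" for a :: "int list" by (intro sum_list_nonneg) auto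
  have "((\<lambda>a. exp (- pi * x * of_int (\<Sum>b\<leftarrow>a. b\<^sup>2))) has_sum jtheta x ^ k) {a. length a = k}
      \<longleftrightarrow> (?f has_sum jtheta x ^ k) (Sigma UNIV ?A)"
    by (rule has_sum_reindex_bij_witness[where i = snd and j = "\<lambda>a. (nat (\<Sum>b\<leftarrow>a. b\<^sup>2), a)"])
       (use nn in auto)
  hence "(?f has_sum jtheta x ^ k) (Sigma UNIV ?A)"
    using jtheta_power_has_sum_lists[OF x, of k] by blast
  moreover have "((\<lambda>a. ?f (n, a)) has_sum (real (num_sum_squares k n) * exp (- pi * x * real n))) (?A n)" for n
    using has_sum_finite[OF finite_sum_squares_eq, of "\<lambda>a. ?f (n, a)" k n] by (simp add: num_sum_squares_def)
  ultimately have "((\<lambda>n. real (num_sum_squares k n) * exp (- pi * x * real n)) has_sum jtheta x ^ k) UNIV"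
    by (rule has_sum_Sigma')
  thus ?thesis by (rule has_sum_imp_sums)
qed

text \<open>The term n = 0 produces the two expressions that stand outside the series in the
  theorem.\<close>

lemma num_sum_squares_0: "num_sum_squares k 0 = 1"
proof -
  have "{a :: int list. length a = k \<and> (\<Sum>b\<leftarrow>a. b\<^sup>2) = int 0} = {replicate k 0}"
  proof safe
    fix a :: "int list" assume "(\<Sum>b\<leftarrow>a. b\<^sup>2) = int 0"
    hence "\<forall>b\<in>set a. b = 0"
      by (subst (asm) of_nat_0, subst (asm) sum_list_nonneg_eq_0_iff) auto
    thus "a = replicate (length a) 0" by (simp add: replicate_length_same)
  qed (simp_all add: sum_list_replicate)
  thus ?thesis by (simp add: num_sum_squares_def)
qed

subsection \<open>The entire part of the Bessel functions and Poisson's integral\<close>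

text \<open>\<open>I\<^sub>\<nu>(z) = (z/2)^\<nu> bessel_entire \<nu> (z\<^sup>2/4)\<close> and \<open>J\<^sub>\<nu>(z) = (z/2)^\<nu> bessel_entire \<nu> (- z\<^sup>2/4)\<close>.\<close>

definition bessel_coeff :: "real \<Rightarrow> nat \<Rightarrow> real" where
  "bessel_coeff \<nu> m = 1 / (fact m * Gamma (real m + \<nu> + 1))"

definition bessel_entire :: "real \<Rightarrow> 'a \<Rightarrow> 'a :: {banach, real_normed_field}" where
  "bessel_entire \<nu> u = (\<Sum>m. of_real (bessel_coeff \<nu> m) * u ^ m)"

lemma bessel_coeff_pos: "\<nu> > -1 \<Longrightarrow> bessel_coeff \<nu> m > 0"
  unfolding bessel_coeff_def by (intro divide_pos_pos mult_pos_pos Gamma_real_pos) auto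

lemma bessel_coeff_Suc:
  assumes "\<nu> > -1"
  shows "bessel_coeff \<nu> (Suc m) = bessel_coeff \<nu> m / ((real m + 1) * (real m + \<nu> + 1))"
proof -
  have "real m + \<nu> + 1 \<notin> \<int>\<^sub>\<le>\<^sub>0" using assms by (auto dest: nonpos_Ints_nonpos)
  hence "Gamma (real (Suc m) + \<nu> + 1) = (real m + \<nu> + 1) * Gamma (real m + \<nu> + 1)"
    using Gamma_plus1[of "real m + \<nu> + 1"] by (simp add: add_ac)
  thus ?thesis by (simp add: bessel_coeff_def)
qed

lemma summable_norm_bessel_entire:
  fixes u :: "'a :: {banach, real_normed_field}"
  assumes "\<nu> > -1"
  shows "summable (\<lambda>m. norm (of_real (bessel_coeff \<nu> m) * u ^ m))"
proof -
  \<comment> \<open>Beyond N, n + 1 exceeds twice the norm of u and n + \<nu> + 1 is at least 1, so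
    the ratio of consecutive terms is at most 1/2.\<close>
  obtain N :: nat where N: "real N > max 1 (max (2 * norm u) (- \<nu>))" using reals_Archimedean2 by blast
  show ?thesis
  proof (rule summable_ratio_test[of "1/2" N])
    fix n assume n: "n \<ge> N"
    have nu: "2 * norm u \<le> real n" "real n + \<nu> \<ge> 0" using N n by auto
    have "2 * norm u * 1 \<le> (real n + 1) * (real n + \<nu> + 1)"
      using nu by (intro mult_mono) auto
    moreover have "(real n + 1) * (real n + \<nu> + 1) > 0" using nu by simp
    ultimately have "norm u / ((real n + 1) * (real n + \<nu> + 1)) \<le> 1/2"
      by (simp only: pos_divide_le_eq)
    hence "(bessel_coeff \<nu> n * norm u ^ n) * (norm u / ((real n + 1) * (real n + \<nu> + 1)))
        \<le> (bessel_coeff \<nu> n * norm u ^ n) * (1/2)"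
      using bessel_coeff_pos[OF assms, of n] by (intro mult_left_mono) auto
    moreover have norm_eq: "norm (of_real (bessel_coeff \<nu> i) * u ^ i) = bessel_coeff \<nu> i * norm u ^ i" for i
      using bessel_coeff_pos[OF assms, of i] by (simp add: norm_mult norm_power)
    moreover have "norm (of_real (bessel_coeff \<nu> (Suc n)) * u ^ Suc n)
        = (bessel_coeff \<nu> n * norm u ^ n) * (norm u / ((real n + 1) * (real n + \<nu> + 1)))"
      by (subst norm_eq) (simp add: bessel_coeff_Suc[OF assms] mult_ac)
    ultimately have "norm (of_real (bessel_coeff \<nu> (Suc n)) * u ^ Suc n)
        \<le> norm (of_real (bessel_coeff \<nu> n) * u ^ n) * (1/2)" by (simp only: norm_eq[of n])
    thus "norm (norm (of_real (bessel_coeff \<nu> (Suc n)) * u ^ Suc n))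
        \<le> 1/2 * norm (norm (of_real (bessel_coeff \<nu> n) * u ^ n))"
      by (simp only: real_norm_def abs_norm_cancel mult.commute)
  qed simp
qed

lemmas summable_bessel_entire = summable_norm_bessel_entire[THEN summable_norm_cancel]

lemma bessel_entire_of_real:
  assumes "\<nu> > -1"
  shows "bessel_entire \<nu> (of_real u :: complex) = of_real (bessel_entire \<nu> u)"
proof -
  have "(\<lambda>m. of_real (of_real (bessel_coeff \<nu> m) * u ^ m) :: complex) sums of_real (bessel_entire \<nu> u)"
    unfolding bessel_entire_def using summable_bessel_entire[OF assms] by (intro sums_of_real summable_sums)
  thus ?thesis by (simp add: bessel_entire_def sums_iff)
qed

lemma bessel_entire_nonneg: "\<nu> > -1 \<Longrightarrow> u \<ge> 0 \<Longrightarrow> bessel_entire \<nu> (u :: real) \<ge> 0"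
  unfolding bessel_entire_def
  by (intro suminf_nonneg summable_bessel_entire) (auto intro!: mult_nonneg_nonneg less_imp_le[OF bessel_coeff_pos])

text \<open>The coefficients are positive, so the real value at v dominates. This carries
  convergence over from real to complex parameters.\<close>

lemma norm_bessel_entire_le:
  fixes u :: complex
  assumes "\<nu> > -1" "norm u \<le> v"
  shows "norm (bessel_entire \<nu> u) \<le> bessel_entire \<nu> v"
  unfolding bessel_entire_def
proof (rule order_trans[OF summable_norm])
  show "summable (\<lambda>m. norm (of_real (bessel_coeff \<nu> m) * u ^ m))"
    by (rule summable_norm_bessel_entire[OF assms(1)])
  show "(\<Sum>m. norm (of_real (bessel_coeff \<nu> m) * u ^ m)) \<le> (\<Sum>m. of_real (bessel_coeff \<nu> m) * v ^ m)"
    using assms bessel_coeff_pos[OF assms(1)]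
    by (intro suminf_le summable_norm_bessel_entire summable_bessel_entire)
      (auto simp: norm_mult norm_power less_imp_le intro!: mult_mono power_mono)
qed

lemma field_differentiable_bessel_entire:
  assumes "\<nu> > -1"
  shows "bessel_entire \<nu> field_differentiable (at (u :: complex))"
  unfolding bessel_entire_def field_differentiable_def
  by (rule exI, rule termdiffs_strong[where K = "of_real (norm u + 1)"])
     (auto intro!: summable_bessel_entire assms)

section \<open>Even moments of the weight and Poisson's integral\<close>

lemma even_moment_beta_weight:
  assumes a: "a > 0"
  shows "(\<integral>\<^sup>+s. ennreal (s ^ (2 * m) * (1 - s\<^sup>2) powr (a - 1) * indicator {-1..1} s) \<partial>lborel)
         = ennreal (Beta (real m + 1/2) a)"
proof -
  let ?w = "\<lambda>s::real. s ^ (2 * m) * (1 - s\<^sup>2) powr (a - 1)"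
  have "((\<lambda>t. t powr (real m - 1/2) * (1 - t) powr (a - 1)) has_integral Beta (real m + 1/2) a) {0..1}"
    using has_integral_Beta_real[of "real m + 1/2" a] a by (simp add: algebra_simps)
  from nn_integral_has_integral_lebesgue[OF _ this] have
     "ennreal (Beta (real m + 1/2) a) =
        nn_integral lborel (\<lambda>t. ennreal (t powr (real m - 1/2) * (1 - t) powr (a - 1) * indicator {0^2..1^2} t))"
    by (simp add: mult_ac ennreal_mult' ennreal_indicator)
  \<comment> \<open>The substitution t = s^2 turns the Beta integral into twice the half-range
    moment; reflection then supplies the negative half.\<close>
  also have "\<dots> = (\<integral>\<^sup>+ s. ennreal (s\<^sup>2 powr (real m - 1/2) * (1 - s\<^sup>2) powr (a - 1) * (2 * s) *
                          indicator {0..1} s) \<partial>lborel)"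
    by (subst nn_integral_substitution[where g = "\<lambda>x. x ^ 2" and g' = "\<lambda>x. 2 * x"])
       (auto intro!: derivative_eq_intros continuous_intros simp: set_borel_measurable_def)
  also have "\<dots> = (\<integral>\<^sup>+ s. 2 * ennreal (?w s * indicator {0..1} s) \<partial>lborel)"
  \<comment> \<open>For m = 0 the integrands differ at s = 0, where \<open>powr\<close> has the
    value 0, so the equality is only almost everywhere.\<close>
  proof (intro nn_integral_cong_AE AE_I[of _ _ "{0}"])
    have "ennreal (s\<^sup>2 powr (real m - 1/2) * (1 - s\<^sup>2) powr (a - 1) * (2 * s) * indicator {0..1} s)
        = 2 * ennreal (?w s * indicator {0..1} s)" if "s \<noteq> 0" for s :: real
    proof (cases "s \<in> {0..1}")
      case True
      hence s: "s > 0" using that by auto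
      have "s\<^sup>2 powr (real m - 1/2) * s = s powr (2 * (real m - 1/2)) * s powr 1"
        using s by (simp add: powr_powr flip: powr_numeral)
      also have "\<dots> = s ^ (2 * m)"
        using s by (subst powr_add[symmetric]) (simp add: powr_realpow[symmetric])
      finally have "s\<^sup>2 powr (real m - 1/2) * (1 - s\<^sup>2) powr (a - 1) * (2 * s) = 2 * ?w s" by (simp add: mult_ac)
      hence "ennreal (s\<^sup>2 powr (real m - 1/2) * (1 - s\<^sup>2) powr (a - 1) * (2 * s)) = ennreal 2 * ennreal (?w s)"
        by (simp only: ennreal_mult'[of 2, symmetric] zero_le_numeral)
      thus ?thesis using True by simp
    qed auto
    thus "{s \<in> space lborel. ennreal (s\<^sup>2 powr (real m - 1/2) * (1 - s\<^sup>2) powr (a - 1) * (2 * s) * indicator {0..1} s)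
        \<noteq> 2 * ennreal (?w s * indicator {0..1} s)} \<subseteq> {0}" by blast
  qed auto
  also have "\<dots> = (\<integral>\<^sup>+ s. ennreal (?w s * indicator {0..1} s) \<partial>lborel) +
                  (\<integral>\<^sup>+ s. ennreal (?w s * indicator {0..1} s) \<partial>lborel)"
    (is "_ = ?I + _") by (simp add: mult_2 nn_integral_add)
  also have "?I = (\<integral>\<^sup>+ s. ennreal (?w s * indicator {-1..0} s) \<partial>lborel)"
    by (subst nn_integral_real_affine[of _ "-1" 0])
       (auto simp: indicator_def intro!: nn_integral_cong)
  hence "?I + ?I = \<dots> + ?I" by simp
  also have "\<dots> = (\<integral>\<^sup>+ s. ennreal (?w s * (indicator {-1..0} s + indicator{0..1} s)) \<partial>lborel)"
    by (subst nn_integral_add [symmetric])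
      (auto simp: algebra_simps zero_le_even_power indicator_def intro!: nn_integral_cong)
  also have "\<dots> = (\<integral>\<^sup>+ s. ennreal (?w s * indicator {-1..1} s) \<partial>lborel)"
    by (intro nn_integral_cong_AE AE_I[of _ _ "{0}"]) (auto simp: indicator_def)
  finally show ?thesis ..
qed

text \<open>By (2m)! = 4^m (1/2)_m m! and Gamma(m + 1/2) = sqrt pi (1/2)_m, with (1/2)_m the
  Pochhammer symbol, the Pochhammer factors cancel. What remains is m! Gamma(m + a + 1/2) in the
  denominator.\<close>

lemma Beta_half_eq_bessel_coeff:
  assumes a: "a > 0"
  shows "Beta (real m + 1/2) a / fact (2 * m) = sqrt pi * Gamma a * bessel_coeff (a - 1/2) m / 4 ^ m"
proof -
  have p: "pochhammer (1/2 :: real) m > 0" by (rule pochhammer_pos) simp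
  have "1 / 2 \<notin> (\<int>\<^sub>\<le>\<^sub>0 :: real set)" by (auto dest: nonpos_Ints_nonpos)
  hence "pochhammer (1/2) m = Gamma (1/2 + real m) / sqrt pi"
    using pochhammer_Gamma[of "1/2 :: real" m] by (simp add: Gamma_one_half_real)
  hence G: "Gamma (real m + 1/2) = sqrt pi * pochhammer (1/2) m" by (simp add: add.commute field_simps)
  have "fact (2 * m) = (4 ^ m * pochhammer (1/2) m * fact m :: real)" by (simp add: fact_double power_mult)
  thus ?thesis using p unfolding Beta_def G bessel_coeff_def by (simp add: field_simps)
qed

lemma cosh_sums: "(\<lambda>m. x ^ (2 * m) / fact (2 * m)) sums cosh (x :: real)"
proof -
  have "(\<lambda>m. (\<lambda>n. if even n then x ^ n /\<^sub>R fact n else 0) (2 * m)) sums cosh x"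
    by (subst sums_mono_reindex) (auto intro: strict_monoI cosh_converges elim!: evenE)
  thus ?thesis by (simp add: field_simps)
qed

text \<open>The weight is even, so the exponential may be replaced by the hyperbolic cosine. All
  terms of its power series are nonnegative, and termwise integration of nonnegative functions needs
  no convergence argument.\<close>

lemma poisson_integral_exp:
  assumes a: "a > 0"
  shows "(\<integral>\<^sup>+s. ennreal ((1 - s\<^sup>2) powr (a - 1) * indicator {-1..1} s * exp (c * s)) \<partial>lborel)
         = ennreal (sqrt pi * Gamma a * bessel_entire (a - 1/2) ((c / 2)\<^sup>2))"
proof -
  let ?w = "\<lambda>s::real. (1 - s\<^sup>2) powr (a - 1) * indicator {-1..1} s"
  let ?I = "\<lambda>c. \<integral>\<^sup>+s. ennreal (?w s * exp (c * s)) \<partial>lborel"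
  have nu: "a - 1/2 > -1" using a by simp
  have K: "sqrt pi * Gamma a \<ge> 0" using a by (simp add: less_imp_le)
  have "?I c = ?I (- c)"
    by (subst nn_integral_real_affine[of _ "-1" 0])
       (auto simp: indicator_def intro!: nn_integral_cong)
  hence "2 * ?I c = ?I c + ?I (- c)" by (simp add: mult_2)
  also have "\<dots> = (\<integral>\<^sup>+s. 2 * ennreal (?w s * cosh (c * s)) \<partial>lborel)"
  proof (subst nn_integral_add [symmetric])
    have "ennreal (?w s * exp (c * s)) + ennreal (?w s * exp (- c * s)) = 2 * ennreal (?w s * cosh (c * s))" for s
    proof -
      have "ennreal (?w s * exp (c * s)) + ennreal (?w s * exp (- c * s)) = ennreal (2 * (?w s * cosh (c * s)))"
        by (subst ennreal_plus[symmetric]) (auto simp: cosh_field_def intro!: arg_cong[of _ _ ennreal], simp add: algebra_simps)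
      also have "\<dots> = ennreal 2 * ennreal (?w s * cosh (c * s))" by (rule ennreal_mult') simp
      finally show ?thesis by simp
    qed
    thus "(\<integral>\<^sup>+s. ennreal (?w s * exp (c * s)) + ennreal (?w s * exp (- c * s)) \<partial>lborel)
       = (\<integral>\<^sup>+s. 2 * ennreal (?w s * cosh (c * s)) \<partial>lborel)" by simp
  qed auto
  also have "\<dots> = 2 * (\<integral>\<^sup>+s. ennreal (?w s * cosh (c * s)) \<partial>lborel)"
    by (intro nn_integral_cmult) (auto simp: cosh_field_def)
  finally have "?I c = (\<integral>\<^sup>+s. ennreal (?w s * cosh (c * s)) \<partial>lborel)"
    by (simp add: ennreal_mult_cancel_left)
  also have "\<dots> = (\<integral>\<^sup>+s. (\<Sum>m. ennreal (c ^ (2 * m) / fact (2 * m)) * ennreal (s ^ (2 * m) * (1 - s\<^sup>2) powr (a - 1) * indicator {-1..1} s)) \<partial>lborel)"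
  proof (intro nn_integral_cong)
    fix s :: real
    have "(\<lambda>m. ?w s * ((c * s) ^ (2 * m) / fact (2 * m))) sums (?w s * cosh (c * s))"
      by (intro sums_mult cosh_sums)
    moreover have "?w s * ((c * s) ^ (2 * m) / fact (2 * m)) \<ge> 0" for m
      by (intro mult_nonneg_nonneg divide_nonneg_nonneg zero_le_even_power) auto
    ultimately have "(\<Sum>m. ennreal (?w s * ((c * s) ^ (2 * m) / fact (2 * m)))) = ennreal (?w s * cosh (c * s))"
      by (subst suminf_ennreal2) (auto simp: sums_iff)
    moreover have "ennreal (c ^ (2 * m) / fact (2 * m)) * ennreal (s ^ (2 * m) * (1 - s\<^sup>2) powr (a - 1) * indicator {-1..1} s)
       = ennreal (?w s * ((c * s) ^ (2 * m) / fact (2 * m)))" for m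
      by (subst ennreal_mult'[symmetric]) (auto simp: power_mult_distrib zero_le_even_power mult_ac)
    ultimately show "ennreal (?w s * cosh (c * s))
       = (\<Sum>m. ennreal (c ^ (2 * m) / fact (2 * m)) * ennreal (s ^ (2 * m) * (1 - s\<^sup>2) powr (a - 1) * indicator {-1..1} s))"
      by simp
  qed
  also have "\<dots> = (\<Sum>m. ennreal (c ^ (2 * m) / fact (2 * m)) * ennreal (Beta (real m + 1/2) a))"
    by (subst nn_integral_suminf, simp, subst nn_integral_cmult) (simp_all add: even_moment_beta_weight[OF a])
  also have "\<dots> = (\<Sum>m. ennreal (sqrt pi * Gamma a * (bessel_coeff (a - 1/2) m * ((c / 2)\<^sup>2) ^ m)))"
  proof (intro suminf_cong)
    fix m
    have "ennreal (c ^ (2 * m) / fact (2 * m)) * ennreal (Beta (real m + 1/2) a)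
       = ennreal (c ^ (2 * m) * (Beta (real m + 1/2) a / fact (2 * m)))"
      by (subst ennreal_mult'[symmetric]) (auto simp: zero_le_even_power)
    also have "c ^ (2 * m) * (Beta (real m + 1/2) a / fact (2 * m)) = sqrt pi * Gamma a * (bessel_coeff (a - 1/2) m * ((c / 2)\<^sup>2) ^ m)"
      unfolding Beta_half_eq_bessel_coeff[OF a] by (simp add: power_mult power_divide)
    finally show "ennreal (c ^ (2 * m) / fact (2 * m)) * ennreal (Beta (real m + 1/2) a)
      = ennreal (sqrt pi * Gamma a * (bessel_coeff (a - 1/2) m * ((c / 2)\<^sup>2) ^ m))" .
  qed
  also have "\<dots> = ennreal (\<Sum>m. sqrt pi * Gamma a * (bessel_coeff (a - 1/2) m * ((c / 2)\<^sup>2) ^ m))"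
    using summable_bessel_entire[OF nu, of "(c / 2)\<^sup>2"] K bessel_coeff_pos[OF nu]
    by (intro suminf_ennreal2) (auto intro!: mult_nonneg_nonneg summable_mult simp: less_imp_le)
  also have "(\<Sum>m. sqrt pi * Gamma a * (bessel_coeff (a - 1/2) m * ((c / 2)\<^sup>2) ^ m)) = sqrt pi * Gamma a * bessel_entire (a - 1/2) ((c / 2)\<^sup>2)"
    unfolding bessel_entire_def using summable_bessel_entire[OF nu, of "(c / 2)\<^sup>2"] by (subst suminf_mult) auto
  finally show ?thesis .
qed

subsection \<open>The identity for the modified Bessel function\<close>

text \<open>The square of the paper's \<open>y\<close> is the variable \<open>w\<close>; negative \<open>w\<close> belong to \<open>J\<^sub>\<nu>\<close>.\<close>

definition bessel_theta_term :: "nat \<Rightarrow> 'a \<Rightarrow> 'a \<Rightarrow> nat \<Rightarrow> 'a :: {banach, real_normed_field}" where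
  "bessel_theta_term k x w n =
     of_nat (num_sum_squares k n) * exp (- (of_real (pi * real n) * x)) *
     bessel_entire (real k / 4 - 1 / 2) ((of_real (pi * real n) / 2)\<^sup>2 * w)"

lemma bessel_theta_term_nonneg:
  assumes "k \<ge> 1" "w \<ge> 0"
  shows "bessel_theta_term k x w n \<ge> (0 :: real)"
  unfolding bessel_theta_term_def using assms
  by (intro mult_nonneg_nonneg bessel_entire_nonneg) auto

lemma jtheta_measurable [measurable]: "jtheta \<in> borel_measurable borel"
  unfolding jtheta_def by measurable

text \<open>The power of theta is expanded into exponentials and integrated term by term. Since
  everything is nonnegative, the identity holds first in the extended reals, and summability follows
  from finiteness of the integral.\<close>

lemma poisson_integral_jtheta:
  fixes k :: nat and x y :: real
  assumes k: "k \<ge> 1" and xy: "\<bar>y\<bar> < x"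
  defines "K \<equiv> sqrt pi * Gamma (real k / 4)"
  shows "summable (bessel_theta_term k x (y\<^sup>2))"
    and "(\<integral>\<^sup>+s. ennreal ((1 - s\<^sup>2) powr (real k / 4 - 1) * jtheta (x + y * s) ^ k * indicator {-1..1} s) \<partial>lborel)
         = ennreal (K * (\<Sum>n. bessel_theta_term k x (y\<^sup>2) n))"
proof -
  let ?r = "\<lambda>n. real (num_sum_squares k n)"
  let ?w = "\<lambda>s::real. (1 - s\<^sup>2) powr (real k / 4 - 1) * indicator {-1..1} s"
  let ?I = "\<integral>\<^sup>+s. ennreal ((1 - s\<^sup>2) powr (real k / 4 - 1) * jtheta (x + y * s) ^ k * indicator {-1..1} s) \<partial>lborel"
  have a: "real k / 4 > 0" using k by simp
  have K: "K > 0" unfolding K_def using a by simp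
  have pos: "x + y * s > 0" "x + y * s \<ge> x - \<bar>y\<bar>" if "s \<in> {-1..1}" for s
  proof -
    have "\<bar>y * s\<bar> \<le> \<bar>y\<bar> * 1" unfolding abs_mult using that by (intro mult_left_mono) auto
    thus "x + y * s > 0" "x + y * s \<ge> x - \<bar>y\<bar>" using xy by auto
  qed
  have "?I = (\<integral>\<^sup>+s. (\<Sum>n. ennreal (?r n * exp (- (pi * real n) * x)) * ennreal (?w s * exp ((- (pi * real n) * y) * s))) \<partial>lborel)"
  proof (intro nn_integral_cong)
    fix s :: real
    have term_eq: "ennreal (?r n * exp (- (pi * real n) * x)) * ennreal (?w s * exp ((- (pi * real n) * y) * s))
       = ennreal (?w s * (?r n * exp (- pi * (x + y * s) * real n)))" for n
      by (subst ennreal_mult'[symmetric]) (auto simp: mult_ac exp_add[symmetric] algebra_simps)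
    show "ennreal ((1 - s\<^sup>2) powr (real k / 4 - 1) * jtheta (x + y * s) ^ k * indicator {-1..1} s)
      = (\<Sum>n. ennreal (?r n * exp (- (pi * real n) * x)) * ennreal (?w s * exp ((- (pi * real n) * y) * s)))"
    proof (cases "s \<in> {-1..1}")
      case True
      have "(\<lambda>n. ?w s * (?r n * exp (- pi * (x + y * s) * real n))) sums (?w s * jtheta (x + y * s) ^ k)"
        using jtheta_power_sums[OF pos(1)[OF True]] by (rule sums_mult)
      thus ?thesis unfolding term_eq
        by (subst suminf_ennreal2) (auto simp: sums_iff mult_ac)
    qed (simp add: term_eq)
  qed
  also have "\<dots> = (\<Sum>n. ennreal (?r n * exp (- (pi * real n) * x)) *
       ennreal (K * bessel_entire (real k / 4 - 1/2) (((- (pi * real n) * y) / 2)\<^sup>2)))"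
    by (subst nn_integral_suminf, simp, subst nn_integral_cmult, simp)
       (simp only: poisson_integral_exp[OF a] K_def)
  also have "\<dots> = (\<Sum>n. ennreal (K * bessel_theta_term k x (y\<^sup>2) n))"
  proof (intro suminf_cong)
    fix n
    have "((- (pi * real n) * y) / 2)\<^sup>2 = (pi * real n / 2)\<^sup>2 * y\<^sup>2" by (simp add: power2_eq_square)
    thus "ennreal (?r n * exp (- (pi * real n) * x)) *
       ennreal (K * bessel_entire (real k / 4 - 1/2) (((- (pi * real n) * y) / 2)\<^sup>2))
       = ennreal (K * bessel_theta_term k x (y\<^sup>2) n)"
      by (subst ennreal_mult'[symmetric]) (simp_all add: bessel_theta_term_def mult_ac)
  qed
  finally have I: "?I = (\<Sum>n. ennreal (K * bessel_theta_term k x (y\<^sup>2) n))" .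
  \<comment> \<open>Theta is decreasing and x + y s >= x - |y| > 0, so the integral is at most a
    constant times the zeroth moment of the weight.\<close>
  have "?I \<le> (\<integral>\<^sup>+s. ennreal (jtheta (x - \<bar>y\<bar>) ^ k) * ennreal (s ^ (2 * 0) * (1 - s\<^sup>2) powr (real k / 4 - 1) * indicator {-1..1} s) \<partial>lborel)"
  proof (intro nn_integral_mono)
    fix s :: real
    show "ennreal ((1 - s\<^sup>2) powr (real k / 4 - 1) * jtheta (x + y * s) ^ k * indicator {-1..1} s)
       \<le> ennreal (jtheta (x - \<bar>y\<bar>) ^ k) * ennreal (s ^ (2 * 0) * (1 - s\<^sup>2) powr (real k / 4 - 1) * indicator {-1..1} s)"
    proof (cases "s \<in> {-1..1}")
      case True
      have "jtheta (x + y * s) ^ k \<le> jtheta (x - \<bar>y\<bar>) ^ k"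
        using pos(2)[OF True] xy
        by (intro sums_le[OF _ jtheta_power_sums[OF pos(1)[OF True]] jtheta_power_sums] mult_left_mono)
           (auto intro: mult_right_mono)
      hence "(1 - s\<^sup>2) powr (real k / 4 - 1) * jtheta (x + y * s) ^ k \<le> jtheta (x - \<bar>y\<bar>) ^ k * (1 - s\<^sup>2) powr (real k / 4 - 1)"
        by (subst mult.commute) (intro mult_right_mono; simp)
      thus ?thesis using True by (subst ennreal_mult''[symmetric]) (auto intro: ennreal_leI)
    qed auto
  qed
  also have "\<dots> = ennreal (jtheta (x - \<bar>y\<bar>) ^ k) * ennreal (Beta (real 0 + 1/2) (real k / 4))"
    by (subst nn_integral_cmult, simp, subst even_moment_beta_weight[OF a]) simp
  also have "\<dots> < top" by (simp add: ennreal_mult_less_top)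
  finally have fin: "(\<Sum>n. ennreal (K * bessel_theta_term k x (y\<^sup>2) n)) \<noteq> top" unfolding I by simp
  have nn: "K * bessel_theta_term k x (y\<^sup>2) n \<ge> 0" for n
    using K bessel_theta_term_nonneg[OF k, of "y\<^sup>2"] by simp
  have summ: "summable (\<lambda>n. K * bessel_theta_term k x (y\<^sup>2) n)"
    by (rule summable_suminf_not_top[OF nn fin])
  show summable: "summable (bessel_theta_term k x (y\<^sup>2))"
    using summable_mult[OF summ, of "1 / K"] K by simp
  show "?I = ennreal (K * (\<Sum>n. bessel_theta_term k x (y\<^sup>2) n))"
    unfolding I suminf_ennreal2[OF nn summ] suminf_mult[OF summable] ..
qed

text \<open>Both sides are Poisson integrals of powers of theta, and a Moebius change of variable
  carries one into the other.\<close>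

lemma bessel_theta_inversion_nonneg:
  fixes k :: nat and x y :: real
  assumes k: "k \<ge> 1" and xy: "\<bar>y\<bar> < x"
  defines "D \<equiv> x\<^sup>2 - y\<^sup>2"
  shows "(\<Sum>n. bessel_theta_term k x (y\<^sup>2) n)
       = D powr (- (real k / 4)) * (\<Sum>n. bessel_theta_term k (x / D) (y\<^sup>2 / D\<^sup>2) n)"
proof -
  define a where "a = real k / 4"
  have a: "a > 0" using k by (simp add: a_def)
  have D: "D > 0" unfolding D_def using xy by (simp add: abs_square_less_1 power2_strict_mono abs_le_square_iff[symmetric] not_le[symmetric])
  have X_pos: "x + y * s > 0" if "s \<in> {-1..1}" for s
  proof -
    have "\<bar>y * s\<bar> \<le> \<bar>y\<bar> * 1" unfolding abs_mult using that by (intro mult_left_mono) auto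
    thus ?thesis using xy by auto
  qed
  define g where "g = (\<lambda>s. (x * s + y) / (x + y * s))"
  define g' where "g' = (\<lambda>s. D / (x + y * s)\<^sup>2)"
  \<comment> \<open>The right-hand integral is taken with -y / D instead of y / D. The series only
    sees the square, and this sign makes the argument of theta at t = g s equal to 1 / (x + y
    s).\<close>
  define f where "f = (\<lambda>t. (1 - t\<^sup>2) powr (a - 1) * jtheta (x / D + (- y / D) * t) ^ k)"
  define K where "K = sqrt pi * Gamma a"
  have K: "K > 0" unfolding K_def using a by simp
  have g1: "g (-1) = -1" "g 1 = 1" using X_pos[of 1] X_pos[of "-1"] by (auto simp: g_def field_simps)
  have "\<bar>- y / D\<bar> < x / D" using xy D by (simp add: divide_strict_right_mono)
  from poisson_integral_jtheta[OF k this]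
  have rhs: "(\<integral>\<^sup>+t. ennreal (f t * indicator {-1..1} t) \<partial>lborel) = ennreal (K * (\<Sum>n. bessel_theta_term k (x / D) (y\<^sup>2 / D\<^sup>2) n))"
   and sum_rhs: "summable (bessel_theta_term k (x / D) (y\<^sup>2 / D\<^sup>2))"
    by (simp_all add: f_def K_def a_def power_divide)
  have "(\<integral>\<^sup>+t. ennreal (f t * indicator {-1..1} t) \<partial>lborel) = (\<integral>\<^sup>+t. ennreal (f t * indicator {g (-1)..g 1} t) \<partial>lborel)"
    by (simp only: g1)
  also have "\<dots> = (\<integral>\<^sup>+s. ennreal (f (g s) * g' s * indicator {-1..1} s) \<partial>lborel)"
  proof (rule nn_integral_substitution)
    show "set_borel_measurable borel {g (-1)..g 1} f" unfolding set_borel_measurable_def f_def by measurable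
    show "(g has_real_derivative g' s) (at s)" if "s \<in> {-1..1}" for s
      unfolding g_def g'_def using X_pos[OF that]
      by (auto intro!: derivative_eq_intros simp: D_def field_simps power2_eq_square)
    show "continuous_on {-1..1} g'" unfolding g'_def
      by (intro continuous_intros) (use X_pos in force)
    show "g' s \<ge> 0" for s using D by (simp add: g'_def)
  qed simp
  also have "\<dots> = (\<integral>\<^sup>+s. ennreal (D powr a) * ennreal ((1 - s\<^sup>2) powr (a - 1) * jtheta (x + y * s) ^ k * indicator {-1..1} s) \<partial>lborel)"
  proof (intro nn_integral_cong)
    fix s :: real
    show "ennreal (f (g s) * g' s * indicator {-1..1} s)
       = ennreal (D powr a) * ennreal ((1 - s\<^sup>2) powr (a - 1) * jtheta (x + y * s) ^ k * indicator {-1..1} s)"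
    proof (cases "s \<in> {-1..1}")
      case True
      define X where "X = x + y * s"
      have X: "X > 0" using X_pos[OF True] by (simp add: X_def)
      have s2: "1 - s\<^sup>2 \<ge> 0" using True by (simp add: abs_square_le_1 abs_le_iff)
      have "1 - (g s)\<^sup>2 = (X\<^sup>2 - (x * s + y)\<^sup>2) / X\<^sup>2"
        using X unfolding g_def X_def[symmetric] by (simp add: power_divide field_simps)
      also have "X\<^sup>2 - (x * s + y)\<^sup>2 = (1 - s\<^sup>2) * D" by (simp add: X_def D_def power2_eq_square algebra_simps)
      finally have 1: "1 - (g s)\<^sup>2 = (1 - s\<^sup>2) * (D / X\<^sup>2)" by simp
      have "x / D + (- y / D) * g s = (x * X - y * (x * s + y)) / (D * X)"
        using X D unfolding g_def X_def[symmetric] by (simp add: field_simps)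
      also have "x * X - y * (x * s + y) = D" by (simp add: X_def D_def power2_eq_square algebra_simps)
      finally have 2: "x / D + (- y / D) * g s = 1 / X" using D by simp
      \<comment> \<open>The exponent a - 1 comes from the weight and one further factor from the
        derivative \<open>g'\<close>. The resulting X^(-2a) = X^(-k/2) is the factor in the
        functional equation of the k-th power of theta.\<close>
      have "(D / X\<^sup>2) powr (a - 1) * (D / X\<^sup>2) = (D / X\<^sup>2) powr (a - 1) * (D / X\<^sup>2) powr 1"
        using D X by simp
      also have "\<dots> = (D / X\<^sup>2) powr a" by (subst powr_add[symmetric]) simp
      also have "\<dots> = D powr a * X powr (- (2 * a))"
        using D X by (simp add: powr_divide powr_powr powr_minus_divide flip: powr_numeral)
      finally have 3: "(D / X\<^sup>2) powr (a - 1) * (D / X\<^sup>2) = D powr a * X powr (- (2 * a))" .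
      have "jtheta X ^ k = jtheta (1 / X) ^ k / sqrt X ^ k"
        by (subst jtheta_inversion[OF X]) (simp add: power_divide)
      also have "sqrt X ^ k = X powr (2 * a)"
        using X by (simp add: a_def powr_half_sqrt[symmetric] powr_powr flip: powr_realpow)
      finally have 4: "jtheta X ^ k = X powr (- (2 * a)) * jtheta (1 / X) ^ k" by (simp add: powr_minus field_simps)
      have "f (g s) * g' s = (1 - s\<^sup>2) powr (a - 1) * jtheta (1 / X) ^ k * ((D / X\<^sup>2) powr (a - 1) * (D / X\<^sup>2))"
        unfolding f_def 1 2 g'_def X_def[symmetric] using s2 D X
        by (subst powr_mult) (auto simp: mult_ac)
      also have "\<dots> = D powr a * ((1 - s\<^sup>2) powr (a - 1) * jtheta X ^ k)"
        unfolding 3 4 by (simp add: mult_ac)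
      finally have "f (g s) * g' s = D powr a * ((1 - s\<^sup>2) powr (a - 1) * jtheta X ^ k)" .
      thus ?thesis using True by (simp add: ennreal_mult' X_def)
    qed simp
  qed
  also have "\<dots> = ennreal (D powr a) * ennreal (K * (\<Sum>n. bessel_theta_term k x (y\<^sup>2) n))"
    using poisson_integral_jtheta(2)[OF k xy] by (subst nn_integral_cmult) (auto simp: a_def K_def)
  finally have "ennreal (K * (\<Sum>n. bessel_theta_term k (x / D) (y\<^sup>2 / D\<^sup>2) n))
      = ennreal (D powr a * (K * (\<Sum>n. bessel_theta_term k x (y\<^sup>2) n)))"
    unfolding rhs by (simp add: ennreal_mult')
  moreover have "(\<Sum>n. bessel_theta_term k x (y\<^sup>2) n) \<ge> 0"
    by (intro suminf_nonneg poisson_integral_jtheta(1) k xy bessel_theta_term_nonneg) auto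
  moreover have "(\<Sum>n. bessel_theta_term k (x / D) (y\<^sup>2 / D\<^sup>2) n) \<ge> 0"
    by (intro suminf_nonneg sum_rhs k bessel_theta_term_nonneg) auto
  ultimately have "K * (\<Sum>n. bessel_theta_term k (x / D) (y\<^sup>2 / D\<^sup>2) n)
      = D powr a * (K * (\<Sum>n. bessel_theta_term k x (y\<^sup>2) n))"
    using K by (subst (asm) ennreal_inj) auto
  thus ?thesis using K D by (simp add: a_def powr_minus field_simps)
qed

subsection \<open>Analytic continuation in the square of the second parameter\<close>

lemma bessel_theta_term_of_real:
  assumes "k \<ge> 1"
  shows "bessel_theta_term k (of_real x :: complex) (of_real w) n = of_real (bessel_theta_term k x w n)"
proof -
  have nu: "real k / 4 - 1 / 2 > -1" using assms by simp
  show ?thesis unfolding bessel_theta_term_def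
    by (simp add: bessel_entire_of_real[OF nu, symmetric] exp_of_real[symmetric])
qed

text \<open>A majorant uniform over a half-plane in z and a disc in w, whose summability is the real
  case with \<beta> as the square of the second parameter.\<close>

lemma norm_bessel_theta_term_le:
  fixes z w :: complex
  assumes "k \<ge> 1" "\<alpha> \<le> Re z" "norm w \<le> \<beta>"
  shows "norm (bessel_theta_term k z w n) \<le> bessel_theta_term k \<alpha> \<beta> n"
proof -
  have nu: "real k / 4 - 1 / 2 > -1" using assms by simp
  have "norm (exp (- (complex_of_real (pi * real n) * z))) \<le> exp (- (pi * real n * \<alpha>))"
    using assms by (simp add: norm_exp_eq_Re mult_left_mono)
  moreover have "norm (bessel_entire (real k / 4 - 1 / 2) ((complex_of_real (pi * real n) / 2)\<^sup>2 * w))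
     \<le> bessel_entire (real k / 4 - 1 / 2) ((pi * real n / 2)\<^sup>2 * \<beta>)"
    using assms by (intro norm_bessel_entire_le nu) (auto simp: norm_mult norm_power norm_divide intro!: mult_left_mono)
  ultimately show ?thesis unfolding bessel_theta_term_def norm_mult
    by (intro mult_mono) auto
qed

lemma summable_bessel_theta_majorant:
  assumes "k \<ge> 1" "\<beta> \<ge> 0" "sqrt \<beta> < \<alpha>"
  shows "summable (bessel_theta_term k \<alpha> \<beta>)"
  using poisson_integral_jtheta(1)[OF assms(1), of "sqrt \<beta>" \<alpha>] assms by simp

lemma summable_bessel_theta_term:
  fixes z w :: complex
  assumes "k \<ge> 1" "sqrt (norm w) < Re z"
  shows "summable (bessel_theta_term k z w)"
proof (rule summable_comparison_test)
  show "\<exists>N. \<forall>n\<ge>N. norm (bessel_theta_term k z w n) \<le> bessel_theta_term k (Re z) (norm w) n"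
    using norm_bessel_theta_term_le[OF assms(1)] by blast
  show "summable (bessel_theta_term k (Re z) (norm w))"
    using assms by (intro summable_bessel_theta_majorant) auto
qed

lemma summable_bessel_theta_term_real:
  fixes x w :: real
  assumes "k \<ge> 1" "sqrt \<bar>w\<bar> < x"
  shows "summable (bessel_theta_term k x w)"
proof -
  have "bessel_theta_term k (complex_of_real x) (complex_of_real w) = (\<lambda>n. of_real (bessel_theta_term k x w n))"
    using bessel_theta_term_of_real[OF assms(1)] by blast
  with summable_bessel_theta_term[of k "of_real w" "of_real x"] assms show ?thesis
    by (simp add: summable_complex_of_real)
qed

text \<open>A local Weierstrass test: around each point the terms, which are holomorphic, are
  dominated by one convergent real series.\<close>

lemma holomorphic_on_bessel_theta:
  assumes k: "k \<ge> 1" and S: "open S" and Z: "Z holomorphic_on S" and W: "W holomorphic_on S"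
    and dom: "\<And>s. s \<in> S \<Longrightarrow> sqrt (norm (W s)) < Re (Z s)"
  shows "(\<lambda>s. \<Sum>n. bessel_theta_term k (Z s) (W s) n) holomorphic_on S"
proof -
  have nu: "real k / 4 - 1 / 2 > -1" using k by simp
  have "bessel_entire (real k / 4 - 1 / 2) holomorphic_on UNIV"
    using field_differentiable_bessel_entire[OF nu] by (simp add: holomorphic_on_def field_differentiable_at_within)
  hence B: "(\<lambda>s. bessel_entire (real k / 4 - 1 / 2) (h s)) holomorphic_on S" if "h holomorphic_on S" for h
    using holomorphic_on_compose_gen[OF that, of "bessel_entire (real k / 4 - 1 / 2)" UNIV] by (simp add: o_def)
  have "(\<lambda>s. bessel_theta_term k (Z s) (W s) n) holomorphic_on S" for n
    unfolding bessel_theta_term_def by (intro holomorphic_intros B Z W)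
  hence diff: "(\<lambda>s. bessel_theta_term k (Z s) (W s) n) field_differentiable at s" if "s \<in> S" for s n
    using S that holomorphic_on_imp_differentiable_at by blast
  have major: "\<exists>d h. 0 < d \<and> summable h \<and> range h \<subseteq> \<real>\<^sub>\<ge>\<^sub>0 \<and>
      (\<forall>\<^sub>F n in sequentially. \<forall>t\<in>ball s d \<inter> S. cmod (bessel_theta_term k (Z t) (W t) n) \<le> cmod (h n))"
    if s: "s \<in> S" for s
  proof -
    \<comment> \<open>Two numbers are inserted into the strict inequality at s: near s the norm of W
      stays below \<gamma>^2 and the real part of Z above \<alpha>, and \<gamma> < \<alpha> makes
      the majorant summable.\<close>
    obtain \<gamma> where \<gamma>: "sqrt (norm (W s)) < \<gamma>" "\<gamma> < Re (Z s)" using dense[OF dom[OF s]] by blast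
    obtain \<alpha> where \<alpha>: "\<gamma> < \<alpha>" "\<alpha> < Re (Z s)" using dense[OF \<gamma>(2)] by blast
    have \<gamma>0: "\<gamma> > 0" using \<gamma>(1) by (meson le_less_trans norm_ge_zero real_sqrt_ge_zero)
    have W\<gamma>: "norm (W s) < \<gamma>\<^sup>2" using \<gamma>(1) \<gamma>0 by (metis norm_ge_zero real_sqrt_less_iff real_sqrt_pow2_iff real_sqrt_unique less_imp_le)
    have cont: "isCont Z s" "isCont W s"
      using Z W S s by (auto simp: continuous_on_eq_continuous_at dest!: holomorphic_on_imp_continuous_on)
    have "\<forall>\<^sub>F t in nhds s. \<alpha> < Re (Z t) \<and> norm (W t) < \<gamma>\<^sup>2"
    proof (rule eventually_conj)
      have "((\<lambda>t. Re (Z t)) \<longlongrightarrow> Re (Z s)) (nhds s)"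
        using cont(1) by (intro tendsto_Re) (simp add: isCont_def tendsto_nhds_iff)
      thus "\<forall>\<^sub>F t in nhds s. \<alpha> < Re (Z t)" using \<alpha>(2) by (rule order_tendstoD)
      have "((\<lambda>t. norm (W t)) \<longlongrightarrow> norm (W s)) (nhds s)"
        using cont(2) by (intro tendsto_norm) (simp add: isCont_def tendsto_nhds_iff)
      thus "\<forall>\<^sub>F t in nhds s. norm (W t) < \<gamma>\<^sup>2" using W\<gamma> by (rule order_tendstoD)
    qed
    then obtain d where d: "d > 0" "\<And>t. dist t s < d \<Longrightarrow> \<alpha> < Re (Z t) \<and> norm (W t) < \<gamma>\<^sup>2"
      unfolding eventually_nhds_metric by blast
    let ?h = "\<lambda>n. complex_of_real (bessel_theta_term k \<alpha> (\<gamma>\<^sup>2) n)"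
    have nn: "bessel_theta_term k \<alpha> (\<gamma>\<^sup>2) n \<ge> 0" for n by (rule bessel_theta_term_nonneg[OF k]) simp
    have "summable ?h"
      using summable_bessel_theta_majorant[OF k, of "\<gamma>\<^sup>2" \<alpha>] \<alpha> \<gamma>0 by (simp add: summable_complex_of_real)
    moreover have "range ?h \<subseteq> \<real>\<^sub>\<ge>\<^sub>0" using nn by auto
    moreover have "cmod (bessel_theta_term k (Z t) (W t) n) \<le> cmod (?h n)" if "t \<in> ball s d" for t n
      using norm_bessel_theta_term_le[OF k, of \<alpha> "Z t" "W t" "\<gamma>\<^sup>2" n] d(2)[of t] that nn[of n]
      by (simp add: dist_commute less_imp_le)
    ultimately show ?thesis using d(1)
      by (intro exI[of _ d] exI[of _ ?h] conjI always_eventually allI ballI) simp_all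
  qed
  obtain g where g: "\<forall>s\<in>S. ((\<lambda>n. bessel_theta_term k (Z s) (W s) n) sums g s) \<and> g field_differentiable (at s)"
    by (rule series_differentiable_comparison_complex[OF S diff major])
  hence "g holomorphic_on S" by (auto simp: holomorphic_on_def field_differentiable_at_within)
  thus ?thesis by (rule holomorphic_transform) (use g in \<open>auto simp: sums_iff\<close>)
qed

lemma bessel_theta_inversion_neg:
  fixes k :: nat and x y :: real
  assumes k: "k \<ge> 1" and xy: "\<bar>y\<bar> < x"
  defines "D \<equiv> x\<^sup>2 + y\<^sup>2"
  shows "(\<Sum>n. bessel_theta_term k x (- (y\<^sup>2)) n)
       = D powr (- (real k / 4)) * (\<Sum>n. bessel_theta_term k (x / D) (- (y\<^sup>2) / D\<^sup>2) n)"
proof -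
  have x: "x > 0" using xy by simp
  have y2: "y\<^sup>2 < x\<^sup>2" using xy x by (metis abs_ge_zero power2_abs power_strict_mono zero_less_numeral)
  \<comment> \<open>\<open>Q\<close> continues D = x^2 - y^2 as a function of w = y^2, and
    \<open>V\<close> is cut out by the convergence criterion for the right-hand series. On the ball
    \<open>Q\<close> has positive real part, so its principal power is holomorphic there.\<close>
  define Q :: "complex \<Rightarrow> complex" where "Q = (\<lambda>w. of_real (x\<^sup>2) - w)"
  define V :: "complex set" where "V = {w \<in> ball 0 (x\<^sup>2). sqrt (norm (w / (Q w)\<^sup>2)) < Re (of_real x / Q w)}"
  define F :: "complex \<Rightarrow> complex" where "F = (\<lambda>w. \<Sum>n. bessel_theta_term k (of_real x) w n)"
  define G where "G = (\<lambda>w. Q w powr (- of_real (real k / 4)) * (\<Sum>n. bessel_theta_term k (of_real x / Q w) (w / (Q w)\<^sup>2) n))"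
  have Q_re: "Re (Q w) > 0" if "w \<in> ball 0 (x\<^sup>2)" for w
    using complex_Re_le_cmod[of w] that by (simp add: Q_def)
  hence Q_nz: "Q w \<noteq> 0" if "w \<in> ball 0 (x\<^sup>2)" for w using that by force
  have Q_holo: "Q holomorphic_on A" for A unfolding Q_def by (intro holomorphic_intros)
  have V_open: "open V"
  proof -
    have "continuous_on (ball 0 (x\<^sup>2)) (\<lambda>w. Re (of_real x / Q w) - sqrt (norm (w / (Q w)\<^sup>2)))"
      by (intro continuous_intros holomorphic_on_imp_continuous_on[OF Q_holo]) (use Q_nz in auto)
    hence "open (ball 0 (x\<^sup>2) \<inter> (\<lambda>w. Re (of_real x / Q w) - sqrt (norm (w / (Q w)\<^sup>2))) -` {0<..})"
      by (rule continuous_open_preimage) auto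
    also have "\<dots> = V" by (auto simp: V_def)
    finally show ?thesis .
  qed
  \<comment> \<open>At real t the positive factor x^2 - t cancels from the criterion, which reduces
    to sqrt |t| < x.\<close>
  have real_in_V: "of_real t \<in> V" if "\<bar>t\<bar> < x\<^sup>2" for t
  proof -
    have pos: "x\<^sup>2 - t > 0" using that by auto
    have Q: "Q (of_real t) = of_real (x\<^sup>2 - t)" by (simp add: Q_def)
    have "norm (complex_of_real t / (Q (of_real t))\<^sup>2) = \<bar>t\<bar> / (x\<^sup>2 - t)\<^sup>2"
      unfolding Q using pos by (simp add: norm_divide norm_power del: of_real_diff)
    hence "sqrt (norm (complex_of_real t / (Q (of_real t))\<^sup>2)) = sqrt \<bar>t\<bar> / (x\<^sup>2 - t)"
      using pos by (simp add: real_sqrt_divide)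
    also have "\<dots> < x / (x\<^sup>2 - t)"
      using pos x that by (intro divide_strict_right_mono real_less_lsqrt) auto
    also have "\<dots> = Re (of_real x / Q (of_real t))"
      unfolding Q by (simp only: of_real_divide[symmetric] Re_complex_of_real)
    finally show ?thesis using that by (simp add: V_def)
  qed
  \<comment> \<open>\<open>V\<close> need not be connected, but the component of 0 contains the whole real segment.\<close>
  define C where "C = connected_component_set V 0"
  have C_open: "open C" unfolding C_def by (rule open_connected_component[OF V_open])
  have C_conn: "connected C" unfolding C_def by (rule connected_connected_component)
  have CV: "C \<subseteq> V" unfolding C_def by (rule connected_component_subset)
  have real_in_C: "of_real t \<in> C" if "\<bar>t\<bar> < x\<^sup>2" for t
  proof -
    have "complex_of_real ` {- (x\<^sup>2)<..<x\<^sup>2} \<subseteq> C" unfolding C_def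
    proof (rule connected_component_maximal)
      show "0 \<in> complex_of_real ` {- (x\<^sup>2)<..<x\<^sup>2}" using x by (intro image_eqI[of _ _ 0]) auto
      show "connected (complex_of_real ` {- (x\<^sup>2)<..<x\<^sup>2})"
        by (intro connected_continuous_image continuous_intros) simp
      show "complex_of_real ` {- (x\<^sup>2)<..<x\<^sup>2} \<subseteq> V" using real_in_V by (auto simp: abs_less_iff)
    qed
    thus ?thesis using that by (auto simp: abs_less_iff)
  qed
  have C_ball: "w \<in> ball 0 (x\<^sup>2)" if "w \<in> C" for w using that CV by (auto simp: V_def)
  have holo: "(\<lambda>w. F w - G w) holomorphic_on C"
  proof (rule holomorphic_on_diff)
    show "F holomorphic_on C" unfolding F_def
    proof (rule holomorphic_on_bessel_theta[OF k C_open])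
      fix w assume "w \<in> C"
      hence "norm w < x\<^sup>2" using C_ball by auto
      thus "sqrt (norm w) < Re (of_real x)" using x by (simp add: real_less_lsqrt)
    qed (auto intro!: holomorphic_intros)
    show "G holomorphic_on C" unfolding G_def
    proof (rule holomorphic_on_mult)
      show "(\<lambda>w. Q w powr (- of_real (real k / 4))) holomorphic_on C"
        by (intro holomorphic_intros Q_holo) (use Q_re C_ball in \<open>force simp: complex_nonpos_Reals_iff\<close>)
      show "(\<lambda>w. \<Sum>n. bessel_theta_term k (of_real x / Q w) (w / (Q w)\<^sup>2) n) holomorphic_on C"
      proof (rule holomorphic_on_bessel_theta[OF k C_open])
        show "(\<lambda>w. of_real x / Q w) holomorphic_on C" "(\<lambda>w. w / (Q w)\<^sup>2) holomorphic_on C"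
          by (intro holomorphic_intros Q_holo; use Q_nz C_ball in auto)+
      qed (use CV in \<open>auto simp: V_def\<close>)
    qed
  qed
  have F_real: "F (of_real t) = of_real (\<Sum>n. bessel_theta_term k x t n)" if "\<bar>t\<bar> < x\<^sup>2" for t
  proof -
    have "sqrt \<bar>t\<bar> < x" using that x by (intro real_less_lsqrt) auto
    thus ?thesis unfolding F_def bessel_theta_term_of_real[OF k]
      by (intro suminf_of_real[symmetric] summable_bessel_theta_term_real k)
  qed
  have G_real: "G (of_real t) = of_real ((x\<^sup>2 - t) powr (- (real k / 4)) * (\<Sum>n. bessel_theta_term k (x / (x\<^sup>2 - t)) (t / (x\<^sup>2 - t)\<^sup>2) n))"
    if t: "\<bar>t\<bar> < x\<^sup>2" for t
  proof -
    have pos: "x\<^sup>2 - t > 0" using t by auto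
    have Q: "Q (of_real t) = of_real (x\<^sup>2 - t)" by (simp add: Q_def)
    have e: "of_real x / Q (of_real t) = of_real (x / (x\<^sup>2 - t))" "of_real t / (Q (of_real t))\<^sup>2 = of_real (t / (x\<^sup>2 - t)\<^sup>2)"
      unfolding Q by (simp_all only: of_real_divide of_real_power)
    have "sqrt \<bar>t / (x\<^sup>2 - t)\<^sup>2\<bar> < x / (x\<^sup>2 - t)"
      using real_in_V[OF t] unfolding V_def mem_Collect_eq e norm_of_real Re_complex_of_real by blast
    hence "summable (bessel_theta_term k (x / (x\<^sup>2 - t)) (t / (x\<^sup>2 - t)\<^sup>2))"
      by (rule summable_bessel_theta_term_real[OF k])
    moreover have "Q (of_real t) powr (- of_real (real k / 4)) = of_real ((x\<^sup>2 - t) powr (- (real k / 4)))"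
      unfolding Q using pos powr_of_real[of "x\<^sup>2 - t" "- (real k / 4)"] by simp
    ultimately show ?thesis unfolding G_def e bessel_theta_term_of_real[OF k]
      by (simp add: suminf_of_real)
  qed
  have zero: "F w - G w = 0" if "w \<in> complex_of_real ` {0<..<x\<^sup>2}" for w
  proof -
    from that obtain t where t: "w = of_real t" "0 < t" "t < x\<^sup>2" by (elim imageE) simp
    have "\<bar>sqrt t\<bar> < x" using t x by (simp add: real_less_lsqrt)
    from bessel_theta_inversion_nonneg[OF k this] show ?thesis using t by (simp add: F_real G_real)
  qed
  have neg: "\<bar>- (y\<^sup>2)\<bar> < x\<^sup>2" using y2 by simp
  have "F (of_real (- (y\<^sup>2))) - G (of_real (- (y\<^sup>2))) = 0"
  \<comment> \<open>The difference vanishes on 0 < t < x^2 by the nonnegative case; this set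
    accumulates at 0, which lies in \<open>C\<close>, and \<open>C\<close> also contains -
    y^2.\<close>
  proof (rule analytic_continuation[OF holo C_open C_conn])
    show "of_real ` {0<..<x\<^sup>2} \<subseteq> C" by (intro image_subsetI real_in_C) simp
    show "0 \<in> C" using real_in_C[of 0] x by simp
    show "(0::complex) islimpt of_real ` {0<..<x\<^sup>2}"
    proof -
      have "(0::real) islimpt {0<..<x\<^sup>2}" using x by (simp add: islimpt_greaterThanLessThan1)
      hence "complex_of_real 0 islimpt of_real ` {0<..<x\<^sup>2}"
        by (rule islimpt_isCont_image) (auto simp: eventually_at_filter)
      thus ?thesis by simp
    qed
    show "of_real (- (y\<^sup>2)) \<in> C" by (intro real_in_C neg)
  qed (use zero in auto)
  hence "complex_of_real (\<Sum>n. bessel_theta_term k x (- (y\<^sup>2)) n)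
    = of_real ((x\<^sup>2 - - (y\<^sup>2)) powr (- (real k / 4)) * (\<Sum>n. bessel_theta_term k (x / (x\<^sup>2 - - (y\<^sup>2))) (- (y\<^sup>2) / (x\<^sup>2 - - (y\<^sup>2))\<^sup>2) n))"
    unfolding F_real[OF neg] G_real[OF neg] by (simp only: right_minus_eq)
  thus ?thesis unfolding of_real_eq_iff D_def by simp
qed

subsection \<open>Bessel functions\<close>

text \<open>The sign c = -1 gives the series of J and c = 1 that of I.\<close>

lemma bessel_series_eq_entire:
  assumes "\<nu> > -1" "z > 0"
  shows "(\<Sum>m. c ^ m * (z / 2) powr (2 * real m + \<nu>) / (fact m * Gamma (real m + \<nu> + 1)))
         = (z / 2) powr \<nu> * bessel_entire \<nu> (c * (z / 2)\<^sup>2)"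
proof -
  have "c ^ m * (z / 2) powr (2 * real m + \<nu>) / (fact m * Gamma (real m + \<nu> + 1))
      = (z / 2) powr \<nu> * (of_real (bessel_coeff \<nu> m) * (c * (z / 2)\<^sup>2) ^ m)" for m
  proof -
    have "(z / 2) powr (2 * real m + \<nu>) = (z / 2) ^ (2 * m) * (z / 2) powr \<nu>"
      using assms(2) powr_realpow[of "z / 2" "2 * m"] by (simp add: powr_add)
    thus ?thesis by (simp add: bessel_coeff_def power_mult_distrib power_mult)
  qed
  thus ?thesis unfolding bessel_entire_def
    using suminf_mult[OF summable_bessel_entire[OF assms(1), of "c * (z / 2)\<^sup>2"], of "(z / 2) powr \<nu>"] by simp
qed

text \<open>The explicit factor -1, and 1 in the companion for I, is kept so that the equation
  matches the parameter c of \<open>bessel_series_inversion\<close>.\<close>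

lemma bessel_J_eq_entire:
  "\<nu> > -1 \<Longrightarrow> z > 0 \<Longrightarrow> bessel_J \<nu> z = (z / 2) powr \<nu> * bessel_entire \<nu> (- 1 * (z / 2)\<^sup>2)"
  using bessel_series_eq_entire[of \<nu> z "-1"] by (simp only: bessel_J_def)

lemma bessel_I_eq_entire:
  "\<nu> > -1 \<Longrightarrow> z > 0 \<Longrightarrow> bessel_I \<nu> z = (z / 2) powr \<nu> * bessel_entire \<nu> (1 * (z / 2)\<^sup>2)"
  using bessel_series_eq_entire[of \<nu> z 1] by (simp only: bessel_I_def power_one mult_1)

text \<open>The power of n in the Bessel prefactor cancels the denominator n^\<nu>, leaving a factor
  that does not depend on n.\<close>

lemma bessel_theta_term_eq:
  fixes k :: nat and x y c :: real
  defines "\<nu> \<equiv> real k / 4 - 1 / 2"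
  assumes y: "y > 0" and n: "n > 0"
    and B: "\<And>z. z > 0 \<Longrightarrow> B z = (z / 2) powr \<nu> * bessel_entire \<nu> (c * (z / 2)\<^sup>2)"
  shows "real (num_sum_squares k n) / real n powr \<nu> * exp (- (pi * real n * x)) * B (pi * real n * y)
       = (pi * y / 2) powr \<nu> * bessel_theta_term k x (c * y\<^sup>2) n"
proof -
  have "pi * real n * y / 2 = real n * (pi * y / 2)" by simp
  hence "(pi * real n * y / 2) powr \<nu> = real n powr \<nu> * (pi * y / 2) powr \<nu>"
    using y by (simp only: powr_mult)
  moreover have "c * (pi * real n * y / 2)\<^sup>2 = (pi * real n / 2)\<^sup>2 * (c * y\<^sup>2)"
    by (simp add: power2_eq_square)
  ultimately have "B (pi * real n * y) = real n powr \<nu> * (pi * y / 2) powr \<nu> * bessel_entire \<nu> ((pi * real n / 2)\<^sup>2 * (c * y\<^sup>2))"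
    using y n B[of "pi * real n * y"] by (simp only: mult_pos_pos pi_gt_zero of_nat_0_less_iff)
  thus ?thesis using n by (simp add: bessel_theta_term_def \<nu>_def)
qed

text \<open>A common passage from the entire normalization to the Bessel series: c = -1 with D = x^2
  + y^2 for J, c = 1 with D = x^2 - y^2 for I. The term n = 0 is split off and everything is
  multiplied by (pi y / 2)^\<nu>.\<close>

lemma bessel_series_inversion:
  fixes k :: nat and x y c D :: real
  defines "\<nu> \<equiv> real k / 4 - 1 / 2"
  assumes k: "k \<ge> 1" and y: "y > 0" and D: "D > 0"
    and B: "\<And>z. z > 0 \<Longrightarrow> B z = (z / 2) powr \<nu> * bessel_entire \<nu> (c * (z / 2)\<^sup>2)"
    and sum1: "summable (bessel_theta_term k x (c * y\<^sup>2))"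
    and sum2: "summable (bessel_theta_term k (x / D) (c * (y / D)\<^sup>2))"
    and inv: "(\<Sum>n. bessel_theta_term k x (c * y\<^sup>2) n)
      = D powr (- (real k / 4)) * (\<Sum>n. bessel_theta_term k (x / D) (c * (y / D)\<^sup>2) n)"
  shows "summable (\<lambda>n. real (num_sum_squares k (Suc n)) / real (Suc n) powr \<nu>
               * exp (- pi * real (Suc n) * x) * B (pi * real (Suc n) * y))
     \<and> summable (\<lambda>n. real (num_sum_squares k (Suc n)) / real (Suc n) powr \<nu>
               * exp (- (pi * real (Suc n) * x / D)) * B (pi * real (Suc n) * y / D))
     \<and> (pi * y) powr \<nu> / (2 powr \<nu> * Gamma (real k / 4 + 1 / 2))
           + (\<Sum>n. real (num_sum_squares k (Suc n)) / real (Suc n) powr \<nu>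
               * exp (- pi * real (Suc n) * x) * B (pi * real (Suc n) * y))
         = (pi * y) powr \<nu> / (2 powr \<nu> * Gamma (real k / 4 + 1 / 2) * D powr (real k / 4))
           + 1 / sqrt D * (\<Sum>n. real (num_sum_squares k (Suc n)) / real (Suc n) powr \<nu>
               * exp (- (pi * real (Suc n) * x / D)) * B (pi * real (Suc n) * y / D))"
proof -
  define P where "P = (pi * y / 2) powr \<nu>"
  define u where "u = bessel_theta_term k x (c * y\<^sup>2)"
  define v where "v = bessel_theta_term k (x / D) (c * (y / D)\<^sup>2)"
  have t1: "real (num_sum_squares k (Suc n)) / real (Suc n) powr \<nu>
       * exp (- pi * real (Suc n) * x) * B (pi * real (Suc n) * y) = P * u (Suc n)" for n
    using bessel_theta_term_eq[OF y _ B[unfolded \<nu>_def], of "Suc n" x]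
    by (simp add: P_def u_def \<nu>_def mult_ac)
  have P2: "(pi * (y / D) / 2) powr \<nu> = P * D powr (- \<nu>)"
    using y D powr_divide[of "pi * y / 2" D \<nu>] by (simp add: P_def powr_minus field_simps)
  have t2: "real (num_sum_squares k (Suc n)) / real (Suc n) powr \<nu>
       * exp (- (pi * real (Suc n) * x / D)) * B (pi * real (Suc n) * y / D) = P * D powr (- \<nu>) * v (Suc n)" for n
    using bessel_theta_term_eq[OF _ _ B[unfolded \<nu>_def], of "y / D" "Suc n" "x / D"] y D
    unfolding P2[symmetric] by (simp add: v_def \<nu>_def)
  have Su: "summable (\<lambda>n. u (Suc n))" and Sv: "summable (\<lambda>n. v (Suc n))"
    using sum1 sum2 by (simp_all add: summable_Suc_iff u_def v_def)
  have zero: "bessel_theta_term k X W 0 = 1 / Gamma (real k / 4 + 1 / 2)" for X W :: real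
  proof -
    have "bessel_entire \<nu> (0 :: real) = bessel_coeff \<nu> 0"
      unfolding bessel_entire_def using powser_zero[of "\<lambda>m. of_real (bessel_coeff \<nu> m) :: real"] by simp
    thus ?thesis by (simp add: bessel_theta_term_def num_sum_squares_0 bessel_coeff_def \<nu>_def add.commute)
  qed
  have uv0: "u 0 = 1 / Gamma (real k / 4 + 1 / 2)" "v 0 = 1 / Gamma (real k / 4 + 1 / 2)"
    using zero[of x "c * y\<^sup>2"] zero[of "x / D" "c * (y / D)\<^sup>2"] by (simp_all add: u_def v_def)
  have P_eq: "(pi * y) powr \<nu> / 2 powr \<nu> = P" using y by (simp add: P_def powr_divide)
  have "suminf u = u 0 + (\<Sum>n. u (Suc n))" "suminf v = v 0 + (\<Sum>n. v (Suc n))"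
    using suminf_split_head[of u] suminf_split_head[of v] sum1 sum2 by (simp_all add: u_def v_def)
  hence main: "u 0 + (\<Sum>n. u (Suc n)) = D powr (- (real k / 4)) * (v 0 + (\<Sum>n. v (Suc n)))"
    using inv by (simp add: u_def v_def)
  \<comment> \<open>Since \<nu> + 1/2 = k/4, the factor D^(-k/4) splits into 1 / sqrt D and the
    D^(-\<nu>) that the Bessel prefactor absorbs when y becomes y / D.\<close>
  have "sqrt D * D powr \<nu> = D powr (real k / 4)"
    using D by (simp add: powr_half_sqrt[symmetric] powr_add[symmetric] \<nu>_def)
  hence Dp: "1 / sqrt D * (P * D powr (- \<nu>) * s) = P * (D powr (- (real k / 4)) * s)" for s
    using D by (simp add: powr_minus field_simps)
  have "P * u 0 + (\<Sum>n. P * u (Suc n)) = P * (u 0 + (\<Sum>n. u (Suc n)))"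
    by (simp only: suminf_mult[OF Su] distrib_left)
  also have "\<dots> = P * (D powr (- (real k / 4)) * v 0) + P * (D powr (- (real k / 4)) * (\<Sum>n. v (Suc n)))"
    by (simp only: main distrib_left)
  also have "P * (D powr (- (real k / 4)) * (\<Sum>n. v (Suc n))) = 1 / sqrt D * (\<Sum>n. P * D powr (- \<nu>) * v (Suc n))"
    by (simp only: suminf_mult[OF Sv] Dp)
  finally have total: "P * u 0 + (\<Sum>n. P * u (Suc n))
      = P * (D powr (- (real k / 4)) * v 0) + 1 / sqrt D * (\<Sum>n. P * D powr (- \<nu>) * v (Suc n))" .
  have left0: "P * u 0 = (pi * y) powr \<nu> / (2 powr \<nu> * Gamma (real k / 4 + 1 / 2))"
    unfolding uv0 P_eq[symmetric] by simp
  have right0: "P * (D powr (- (real k / 4)) * v 0) = (pi * y) powr \<nu> / (2 powr \<nu> * Gamma (real k / 4 + 1 / 2) * D powr (real k / 4))"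
    unfolding uv0 P_eq[symmetric] by (simp add: powr_minus_divide)
  show ?thesis unfolding t1 t2 left0[symmetric] right0[symmetric]
    by (intro conjI summable_mult Su Sv total)
qed

theorem theorem1:
  fixes k :: nat and x y :: real
  assumes "k \<ge> 1" and "x > y" and "y > 0"
  shows "(summable (\<lambda>n. real (num_sum_squares k (Suc n)) / real (Suc n) powr (real k / 4 - 1 / 2)
               * exp (- pi * real (Suc n) * x) * bessel_J (real k / 4 - 1 / 2) (pi * real (Suc n) * y))
     \<and> summable (\<lambda>n. real (num_sum_squares k (Suc n)) / real (Suc n) powr (real k / 4 - 1 / 2)
               * exp (- (pi * real (Suc n) * x / (x\<^sup>2 + y\<^sup>2))) * bessel_J (real k / 4 - 1 / 2) (pi * real (Suc n) * y / (x\<^sup>2 + y\<^sup>2)))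
     \<and> (pi * y) powr (real k / 4 - 1 / 2) / (2 powr (real k / 4 - 1 / 2) * Gamma (real k / 4 + 1 / 2))
           + (\<Sum>n. real (num_sum_squares k (Suc n)) / real (Suc n) powr (real k / 4 - 1 / 2)
               * exp (- pi * real (Suc n) * x) * bessel_J (real k / 4 - 1 / 2) (pi * real (Suc n) * y))
         = (pi * y) powr (real k / 4 - 1 / 2) / (2 powr (real k / 4 - 1 / 2) * Gamma (real k / 4 + 1 / 2) * (x\<^sup>2 + y\<^sup>2) powr (real k / 4))
           + 1 / sqrt (x\<^sup>2 + y\<^sup>2) * (\<Sum>n. real (num_sum_squares k (Suc n)) / real (Suc n) powr (real k / 4 - 1 / 2)
               * exp (- (pi * real (Suc n) * x / (x\<^sup>2 + y\<^sup>2))) * bessel_J (real k / 4 - 1 / 2) (pi * real (Suc n) * y / (x\<^sup>2 + y\<^sup>2))))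
    \<and> (summable (\<lambda>n. real (num_sum_squares k (Suc n)) / real (Suc n) powr (real k / 4 - 1 / 2)
               * exp (- pi * real (Suc n) * x) * bessel_I (real k / 4 - 1 / 2) (pi * real (Suc n) * y))
     \<and> summable (\<lambda>n. real (num_sum_squares k (Suc n)) / real (Suc n) powr (real k / 4 - 1 / 2)
               * exp (- (pi * real (Suc n) * x / (x\<^sup>2 - y\<^sup>2))) * bessel_I (real k / 4 - 1 / 2) (pi * real (Suc n) * y / (x\<^sup>2 - y\<^sup>2)))
     \<and> (pi * y) powr (real k / 4 - 1 / 2) / (2 powr (real k / 4 - 1 / 2) * Gamma (real k / 4 + 1 / 2))
           + (\<Sum>n. real (num_sum_squares k (Suc n)) / real (Suc n) powr (real k / 4 - 1 / 2)
               * exp (- pi * real (Suc n) * x) * bessel_I (real k / 4 - 1 / 2) (pi * real (Suc n) * y))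
         = (pi * y) powr (real k / 4 - 1 / 2) / (2 powr (real k / 4 - 1 / 2) * Gamma (real k / 4 + 1 / 2) * (x\<^sup>2 - y\<^sup>2) powr (real k / 4))
           + 1 / sqrt (x\<^sup>2 - y\<^sup>2) * (\<Sum>n. real (num_sum_squares k (Suc n)) / real (Suc n) powr (real k / 4 - 1 / 2)
               * exp (- (pi * real (Suc n) * x / (x\<^sup>2 - y\<^sup>2))) * bessel_I (real k / 4 - 1 / 2) (pi * real (Suc n) * y / (x\<^sup>2 - y\<^sup>2))))"
proof -
  have nu: "real k / 4 - 1 / 2 > -1" and xy: "\<bar>y\<bar> < x"
    using assms by auto
  have Dp: "x\<^sup>2 + y\<^sup>2 > 0" using assms by (intro add_pos_pos) auto
  have Dm: "x\<^sup>2 - y\<^sup>2 > 0" using power_strict_mono[of y x 2] assms by simp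
  \<comment> \<open>The criterion reads y / D < x / D whatever the sign c, so this covers all four
    series; D = 1 gives the left-hand sides.\<close>
  have summable: "summable (bessel_theta_term k (x / D) (c * (y / D)\<^sup>2))"
    if "\<bar>c\<bar> = 1" "D > 0" for c D :: real
  proof (rule summable_bessel_theta_term_real[OF assms(1)])
    show "sqrt \<bar>c * (y / D)\<^sup>2\<bar> < x / D"
      using that assms by (simp add: abs_mult divide_strict_right_mono)
  qed
  have summable1: "summable (bessel_theta_term k x (c * y\<^sup>2))" if "\<bar>c\<bar> = 1" for c :: real
    using summable[OF that, of 1] by simp
  have inv_J: "(\<Sum>n. bessel_theta_term k x (- 1 * y\<^sup>2) n) = (x\<^sup>2 + y\<^sup>2) powr (- (real k / 4)) *
      (\<Sum>n. bessel_theta_term k (x / (x\<^sup>2 + y\<^sup>2)) (- 1 * (y / (x\<^sup>2 + y\<^sup>2))\<^sup>2) n)"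
    using bessel_theta_inversion_neg[OF assms(1) xy] by (simp add: power_divide)
  have inv_I: "(\<Sum>n. bessel_theta_term k x (1 * y\<^sup>2) n) = (x\<^sup>2 - y\<^sup>2) powr (- (real k / 4)) *
      (\<Sum>n. bessel_theta_term k (x / (x\<^sup>2 - y\<^sup>2)) (1 * (y / (x\<^sup>2 - y\<^sup>2))\<^sup>2) n)"
    using bessel_theta_inversion_nonneg[OF assms(1) xy] by (simp add: power_divide)
  have one: "\<bar>- 1 :: real\<bar> = 1" "\<bar>1 :: real\<bar> = 1" by simp_all
  show ?thesis
    by (rule conjI[OF
          bessel_series_inversion[OF assms(1,3) Dp bessel_J_eq_entire[OF nu] summable1[OF one(1)] summable[OF one(1) Dp] inv_J]
          bessel_series_inversion[OF assms(1,3) Dm bessel_I_eq_entire[OF nu] summable1[OF one(2)] summable[OF one(2) Dm] inv_I]])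
qed

end
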